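(* Let $n\geqslant 2$ and let $X_1,\dots,X_n$ be independent real random variables with $\mathbb{E}X_j=0$ and $\mathbb{E}X_j^2=1$. Put $S_n=(X_1+\cdots+X_n)/\sqrt n$ and $S_{n;k}=\frac{1}{\sqrt{n-1}}\sum_{1\leqslant j\leqslant n,\,j\neq k}X_j$. Let $J\subset\mathbb{Z}^+$ be a set of integers such that $\mathbb{E}H_k(X_j)=0$ for all $k\in J$ and all $j=1,\dots,n$. Then \[ \chi^2(S_n,\mathcal N)\leqslant\left(\sum_{j\in\mathbb{Z}^+\setminus J}\frac{1}{n^{j-2}}\right)\frac1n\sum_{k=1}^n\chi^2(X_k,\mathcal N)+\frac{C_J(1/n)}{n}\sum_{k=1}^n\chi^2(X_k,\mathcal N)\,\chi^2(S_{n;k},\mathcal N). \]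
   Context: $\varphi(x)=e^{-x^2/2}/\sqrt{2\pi}$. For a real random variable $Y$ with density $p$, $\chi^2(Y,\mathcal N)=\int_{-\infty}^{\infty}\left(\frac{p(x)}{\varphi(x)}-1\right)^2\varphi(x)\,dx$ (taken to be $+\infty$ if $Y$ has no density). Hermite polynomials $H_n$ are defined by $\sum_{n\geqslant0}\frac{H_n(x)}{n!}z^n=e^{xz-z^2/2}$. $\mathbb{Z}^+$ is the set of positive integers. For $J\subset\mathbb{Z}^+$, $s\in\mathbb{Z}^+$, $0<p<1$: $h_J(s,p)=\frac{(1-p)^s}{p^2}\sum_{k\in\mathbb{Z}^+\setminus J}\frac{k^2}{(k+s)^2}\binom{k+s}{k}p^k$ and $C_J(p)=\max_{s\in\mathbb{Z}^+}h_J(s,p)$. *)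

theory Defs
  imports "HOL-Probability.Probability"
begin

text \<open>Chi-square distance of a real random variable Y (on probability space M) to N(0,1).
  If Y has a Lebesgue density p, the value is the integral of (p/phi - 1)^2 phi;
  otherwise it is infinity. The result does not depend on the choice of the
  density (densities agree a.e.).\<close>
definition chi2 :: "'a measure \<Rightarrow> ('a \<Rightarrow> real) \<Rightarrow> ennreal" where
  "chi2 M Y =
     (if \<exists>p. distributed M lborel Y p
      then (\<integral>\<^sup>+ x. ennreal ((enn2real ((SOME p. distributed M lborel Y p) x)
                                / std_normal_density x - 1)\<^sup>2 * std_normal_density x) \<partial>lborel)
      else \<infinity>)"

text \<open>Hermite polynomials via the generating function exp(x z - z^2/2) = sum H_n(x) z^n / n!,
  i.e. H_n(x) is the n-th derivative in z at z = 0.\<close>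
definition hermite :: "nat \<Rightarrow> real \<Rightarrow> real" where
  "hermite n x = (deriv ^^ n) (\<lambda>z. exp (x * z - z\<^sup>2 / 2)) 0"

definition hJ :: "nat set \<Rightarrow> nat \<Rightarrow> real \<Rightarrow> real" where
  "hJ J s p = (1 - p) ^ s / p\<^sup>2 *
     (\<Sum>\<^sub>\<infinity> k \<in> {k. 1 \<le> k \<and> k \<notin> J}.
        real k ^ 2 / real (k + s) ^ 2 * real ((k + s) choose k) * p ^ k)"

definition CJ :: "nat set \<Rightarrow> real \<Rightarrow> real" where
  "CJ J p = (SUP s \<in> {1..}. hJ J s p)"

end

theory Submission
  imports Defs
begin

text \<open>
  Write \<open>a(k, j) = E H_j(X_k)\<close>, \<open>b(k, s) = E H_s(S_{n;k})\<close> and \<open>A(m) = E H_m(S_n)\<close>. By Parseval,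
  the chi-square distance is the sum of the squared Hermite moments of positive order, divided by
  factorials. Applying the number operator \<open>z d/dz\<close> to the product of the generating functions of
  the \<open>X_k\<close> yields
  \<open>m A(m) = \<Sum>_k \<Sum>_j j (m choose j) n^(-j/2) (1 - 1/n)^((m-j)/2) a(k, j) b(k, m - j)\<close>.
  Cauchy--Schwarz first in \<open>k\<close>, which costs a factor \<open>n\<close>, and then in \<open>j\<close>, bounding
  \<open>\<Sum>_j a(k, j)^2 / j!\<close> by \<open>chi2(X_k)\<close>, leaves for each \<open>s = m - j\<close> the weight
  \<open>h_J(s, 1/n) / n^2\<close>; the terms with \<open>s = 0\<close> give the first sum of the bound.

  For \<open>X_k\<close> and \<open>S_{n;k}\<close> Bessel's inequality is enough. For \<open>S_n\<close> the converse inequality is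
  needed: Riesz--Fischer provides a candidate density with the Hermite moments of \<open>S_n\<close>, and since
  \<open>S_n\<close> has exponential moments of all orders, the Hermite moments determine its characteristic
  function. If \<open>J\<close> contains all positive integers, both coefficients vanish while \<open>chi2(X_k)\<close>
  might a priori be infinite; then the moments force \<open>X_k\<close> to be standard normal.
\<close>

unbundle no vec_syntax
unbundle fps_syntax

subsection \<open>Hermite polynomials\<close>

text \<open>Generated by the raising operator \<open>x - d/dx\<close>. Values in
  \<open>real poly\<close> make \<open>pderiv\<close> and polynomial products available;
  \<open>hermite_eq_He\<close> links them to \<open>hermite\<close>.\<close>

fun He :: "nat \<Rightarrow> real poly" where
  "He 0 = 1"
| "He (Suc n) = [:0, 1:] * He n - pderiv (He n)"

declare He.simps(2) [simp del]

text \<open>Induction: the product rule contributes one extra \<open>He (Suc n)\<close>, and the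
  other terms recombine into a multiple of it by the recursion.\<close>

lemma pderiv_He: "pderiv (He (Suc n)) = smult (real (Suc n)) (He n)"
proof (induction n)
  case (Suc n)
  have "pderiv (He (Suc (Suc n))) = He (Suc n) + [:0, 1:] * pderiv (He (Suc n)) - pderiv (pderiv (He (Suc n)))"
    by (simp add: He.simps(2)[of "Suc n"] pderiv_mult pderiv_diff pderiv_pCons algebra_simps)
  also have "\<dots> = He (Suc n) + smult (real (Suc n)) ([:0, 1:] * He n - pderiv (He n))"
    unfolding Suc by (simp only: pderiv_smult mult_smult_right smult_diff_right add_diff_eq)
  also have "\<dots> = smult (real (Suc (Suc n))) (He (Suc n))"
    by (simp only: He.simps(2)[symmetric] of_nat_Suc[of "Suc n"] smult_add_left smult_1_left)
  finally show ?case .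
qed (simp add: He.simps(2) pderiv_pCons)

text \<open>The lowering relation replaces the derivative in the recursion by the previous
  polynomial. At \<open>n = 0\<close> the truncated index \<open>n - 1\<close> is multiplied by
  zero.\<close>

lemma poly_He_Suc: "poly (He (Suc n)) x = x * poly (He n) x - real n * poly (He (n - 1)) x"
proof (cases n)
  case (Suc k)
  have "poly (He (Suc n)) x = x * poly (He n) x - poly (pderiv (He n)) x"
    by (simp add: He.simps(2))
  then show ?thesis
    by (simp only: Suc pderiv_He) simp
qed (simp add: He.simps(2))

lemma hermite_eq_He: "hermite n x = poly (He n) x"
proof -
  \<comment> \<open>The induction needs the iterated derivative at every \<open>z\<close>, since
    each further derivative uses the formula in a neighbourhood of the point.\<close>
  have "(deriv ^^ n) (\<lambda>z. exp (x * z - z\<^sup>2 / 2)) z = poly (He n) (x - z) * exp (x * z - z\<^sup>2 / 2)" for z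
  proof (induction n arbitrary: z)
    case (Suc n)
    have "(deriv ^^ Suc n) (\<lambda>z. exp (x * z - z\<^sup>2 / 2)) z =
        deriv (\<lambda>z. poly (He n) (x - z) * exp (x * z - z\<^sup>2 / 2)) z"
      unfolding funpow.simps o_def Suc ..
    also have "\<dots> = poly (He (Suc n)) (x - z) * exp (x * z - z\<^sup>2 / 2)"
      by (rule DERIV_imp_deriv) (auto intro!: derivative_eq_intros poly_DERIV simp: He.simps(2) algebra_simps)
    finally show ?case .
  qed simp
  from this[of 0] show ?thesis unfolding hermite_def by simp
qed

subsection \<open>The generating function\<close>

text \<open>The equation expresses \<open>n + 1\<close> times coefficient \<open>n + 1\<close>
  through the coefficients up to \<open>n\<close>, and characteristic zero allows the
  division.\<close>

lemma fps_linear_ODE_unique: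
  fixes A B :: "'a :: field_char_0 fps"
  assumes "fps_deriv A = Q * A" "fps_deriv B = Q * B" "A $ 0 = B $ 0"
  shows "(A :: 'a fps) = B"
proof -
  have "A $ n = B $ n" for n
  proof (induction n rule: less_induct)
    case (less n)
    show ?case
    proof (cases n)
      case (Suc m)
      have "of_nat (m + 1) * A $ (m + 1) = of_nat (m + 1) * B $ (m + 1)"
        unfolding fps_deriv_nth[symmetric] assms fps_mult_nth
        by (intro sum.cong) (auto simp: less Suc)
      then show ?thesis using Suc of_nat_neq_0[of m, where ?'a = 'a] by simp
    qed (simp add: assms)
  qed
  then show ?thesis by (simp add: fps_eq_iff)
qed

text \<open>Formally \<open>exp (s x z - s^2 z^2 / 2)\<close> as a power series in \<open>z\<close>.
  The scale \<open>s\<close> is the weight with which a variable enters a normalised sum.\<close>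

definition hermite_fps :: "real \<Rightarrow> real \<Rightarrow> real fps" where
  "hermite_fps s x = Abs_fps (\<lambda>m. poly (He m) x * s ^ m / fact m)"

lemma hermite_fps_nth_0 [simp]: "hermite_fps s x $ 0 = 1"
  by (simp add: hermite_fps_def)

text \<open>This is the three-term recurrence read coefficientwise; the factor is the derivative of
  the formal exponent \<open>s x z - s^2 z^2 / 2\<close>.\<close>

lemma fps_deriv_hermite_fps:
  "fps_deriv (hermite_fps s x) = (fps_const (s * x) - fps_const (s\<^sup>2) * fps_X) * hermite_fps s x"
proof (rule fps_ext)
  fix m
  show "fps_deriv (hermite_fps s x) $ m =
    ((fps_const (s * x) - fps_const (s\<^sup>2) * fps_X) * hermite_fps s x) $ m"
  proof (cases m)
    case (Suc k)
    have "fps_deriv (hermite_fps s x) $ m = poly (He (Suc m)) x * s ^ Suc m / fact m"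
      by (simp add: hermite_fps_def del: of_nat_Suc)
    also have "\<dots> = s * x * (poly (He m) x * s ^ m / fact m) - s\<^sup>2 * (poly (He k) x * s ^ k / fact k)"
    proof -
      have *: "poly (He (Suc m)) x = x * poly (He m) x - real m * poly (He k) x"
        using poly_He_Suc[of m x] by (simp add: Suc)
      have "real m * poly (He k) x * s ^ Suc m / fact m = s\<^sup>2 * (poly (He k) x * s ^ k / fact k)"
        by (simp add: Suc power2_eq_square field_simps del: of_nat_Suc)
      then show ?thesis
        unfolding * by (simp add: algebra_simps diff_divide_distrib)
    qed
    finally show ?thesis
      by (simp add: Suc hermite_fps_def algebra_simps mult.assoc)
  qed (simp add: hermite_fps_def He.simps(2))
qed

text \<open>Exponents add: under the two assumptions both sides solve the same linear differential
  equation with constant term 1.\<close>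

lemma hermite_fps_mult:
  assumes "s\<^sup>2 + t\<^sup>2 = r\<^sup>2" "s * x + t * y = r * z"
  shows "hermite_fps s x * hermite_fps t y = hermite_fps r z"
proof (rule fps_linear_ODE_unique[OF _ fps_deriv_hermite_fps])
  have *: "fps_const (r\<^sup>2) = fps_const (s\<^sup>2) + fps_const (t\<^sup>2)" "fps_const (r * z) = fps_const (s * x) + fps_const (t * y)"
    by (simp_all add: assms)
  show "fps_deriv (hermite_fps s x * hermite_fps t y) =
    (fps_const (r * z) - fps_const (r\<^sup>2) * fps_X) * (hermite_fps s x * hermite_fps t y)"
    unfolding * fps_deriv_mult fps_deriv_hermite_fps by (simp only: algebra_simps)
qed simp

text \<open>Compares the coefficients of the number operator \<open>z d/dz\<close> applied to the product of the
  generating functions of the \<open>x k\<close>, differentiating one factor at a time.\<close>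
lemma hermite_fps_number_operator:
  fixes n :: nat and x :: "nat \<Rightarrow> real"
  defines "S \<equiv> (\<Sum>k=1..n. x k) / sqrt (real n)"
    and "R \<equiv> \<lambda>k. (\<Sum>i\<in>{1..n} - {k}. x i) / sqrt (real n - 1)"
  assumes n: "n \<ge> 2"
  shows "real m * poly (He m) S / fact m =
    (\<Sum>k=1..n. \<Sum>j\<le>m. real j * (poly (He j) (x k) * (1 / sqrt n) ^ j / fact j) *
       (poly (He (m - j)) (R k) * sqrt (1 - 1 / n) ^ (m - j) / fact (m - j)))"
proof (cases m)
  case (Suc l)
  \<comment> \<open>\<open>?q k\<close> is the logarithmic derivative of the factor belonging to
    \<open>x k\<close>; summed over \<open>k\<close> it gives \<open>S - z\<close>, that of the
    generating function of \<open>S\<close>.\<close>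
  let ?q = "\<lambda>k. fps_const (x k / sqrt n) - fps_const (1 / n) * fps_X :: real fps"
  have *: "hermite_fps (1 / sqrt n) (x k) * hermite_fps (sqrt (1 - 1 / n)) (R k) = hermite_fps 1 S"
    if "k \<in> {1..n}" for k
  proof (rule hermite_fps_mult)
    show "(1 / sqrt n)\<^sup>2 + (sqrt (1 - 1 / n))\<^sup>2 = (1::real)\<^sup>2"
      using n by (simp add: power_divide)
    have "sqrt (1 - 1 / n) = sqrt (real n - 1) / sqrt n"
      using n by (simp add: real_sqrt_divide[symmetric] diff_divide_distrib)
    then have "sqrt (1 - 1 / n) * R k = (\<Sum>i\<in>{1..n} - {k}. x i) / sqrt n"
      using n by (simp add: R_def)
    moreover have "(\<Sum>i=1..n. x i) = x k + (\<Sum>i\<in>{1..n} - {k}. x i)"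
      using that by (intro sum.remove) auto
    ultimately show "1 / sqrt n * x k + sqrt (1 - 1 / n) * R k = 1 * S"
      by (simp add: S_def add_divide_distrib)
  qed
  have "fps_deriv (hermite_fps 1 S) = (\<Sum>k=1..n. ?q k) * hermite_fps 1 S"
  proof -
    have "(\<Sum>k=1..n. ?q k) = fps_const S - fps_X"
    proof (rule fps_ext)
      fix i
      show "(\<Sum>k=1..n. ?q k) $ i = (fps_const S - fps_X) $ i"
        using n by (simp add: fps_sum_nth sum_subtractf S_def sum_divide_distrib)
    qed
    then show ?thesis by (simp add: fps_deriv_hermite_fps)
  qed
  also have "\<dots> = (\<Sum>k=1..n. fps_deriv (hermite_fps (1 / sqrt n) (x k)) * hermite_fps (sqrt (1 - 1 / n)) (R k))"
    unfolding sum_distrib_right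
    by (intro sum.cong refl, subst *[symmetric], assumption) (simp add: fps_deriv_hermite_fps power_divide mult.assoc)
  finally have "fps_deriv (hermite_fps 1 S) $ l = \<dots> $ l" by simp
  then have "real m * poly (He m) S / fact m = (\<Sum>k=1..n. \<Sum>i\<le>l. real (Suc i) * (poly (He (Suc i)) (x k) * (1 / sqrt n) ^ Suc i / fact (Suc i)) *
       (poly (He (l - i)) (R k) * sqrt (1 - 1 / n) ^ (l - i) / fact (l - i)))"
    by (simp add: fps_sum_nth fps_mult_nth hermite_fps_def Suc atLeast0AtMost)
  \<comment> \<open>Shifting \<open>j = Suc i\<close> adds only the term \<open>j = 0\<close>, which
    its factor \<open>real j\<close> annihilates.\<close>
  then show ?thesis
    unfolding Suc sum.atMost_Suc_shift by (simp)
qed simp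

text \<open>The exponential series spread over the even indices, with zeros in between, so that it
  can enter a Cauchy product with a series in \<open>z\<close>.\<close>

lemma sums_exp_mult_square:
  fixes z :: "'a :: {real_normed_field, banach}"
  shows "(\<lambda>j. of_real (if even j then c ^ (j div 2) / fact (j div 2) else 0) * z ^ j) sums exp (of_real c * z\<^sup>2)"
proof (subst sums_mono_reindex[of "\<lambda>k. 2 * k", symmetric])
  show "strict_mono (\<lambda>k::nat. 2 * k)" by (simp add: strict_mono_def)
  have "(\<lambda>k. (of_real c * z\<^sup>2) ^ k /\<^sub>R fact k) sums exp (of_real c * z\<^sup>2)"
    by (rule exp_converges)
  then show "(\<lambda>k. of_real (if even (2 * k) then c ^ (2 * k div 2) / fact (2 * k div 2) else 0) * z ^ (2 * k)) sums
      exp (of_real c * z\<^sup>2)"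
    by (simp add: power_mult_distrib scaleR_conv_of_real field_simps flip: power_mult)
qed auto

text \<open>The Cauchy product of the Taylor coefficients of \<open>exp (x z)\<close> and \<open>exp (- z\<^sup>2 / 2)\<close>.\<close>
lemma He_cauchy_product:
  "poly (He m) x / fact m =
    (\<Sum>i\<le>m. x ^ i / fact i *
      (if even (m - i) then (- 1 / 2) ^ ((m - i) div 2) / fact ((m - i) div 2) else 0))"
proof -
  \<comment> \<open>\<open>D\<close> is the formal series of \<open>exp (- z^2 / 2)\<close>; its
    differential equation and that of \<open>fps_exp x\<close> combine into the one of
    \<open>hermite_fps 1 x\<close>.\<close>
  define D :: "real fps" where
    "D = Abs_fps (\<lambda>j. if even j then (- 1 / 2) ^ (j div 2) / fact (j div 2) else 0)"
  have D: "fps_deriv D = - fps_X * D"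
  proof (rule fps_ext)
    fix j
    show "fps_deriv D $ j = (- fps_X * D) $ j"
    proof (cases "odd j")
      case True
      then obtain b where j: "j = Suc (2 * b)" by (auto elim: oddE)
      have "1 + real b \<noteq> 0" by linarith
      then show ?thesis by (simp add: j D_def divide_simps)
    qed (cases j; simp add: D_def)
  qed
  have "hermite_fps 1 x = fps_exp x * D"
    by (rule fps_linear_ODE_unique[OF fps_deriv_hermite_fps]) (simp_all add: D algebra_simps, simp add: D_def)
  then have "hermite_fps 1 x $ m = (fps_exp x * D) $ m" by simp
  then show ?thesis
    by (simp add: hermite_fps_def D_def fps_mult_nth atLeast0AtMost)
qed

text \<open>A Cauchy product of two absolutely convergent series. The bound, uniform in
  \<open>N\<close>, later serves as the dominating function for integrating the series term by
  term.\<close>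

lemma He_generating_function:
  fixes z :: complex
  shows "(\<lambda>m. z ^ m / fact m * of_real (poly (He m) x)) sums exp (of_real x * z - z\<^sup>2 / 2)"
    and "norm (\<Sum>m<N. z ^ m / fact m * of_real (poly (He m) x)) \<le> exp (\<bar>x\<bar> * norm z + (norm z)\<^sup>2 / 2)"
proof -
  define d :: "nat \<Rightarrow> real" where "d = (\<lambda>j. if even j then (- 1 / 2) ^ (j div 2) / fact (j div 2) else 0)"
  define a where "a = (\<lambda>i. (of_real x * z) ^ i /\<^sub>R fact i)"
  define b where "b = (\<lambda>j. of_real (d j) * z ^ j)"
  have a: "a sums exp (of_real x * z)" unfolding a_def by (rule exp_converges)
  have na: "(\<lambda>i. norm (a i)) sums exp (\<bar>x\<bar> * norm z)"
    using exp_converges[of "\<bar>x\<bar> * norm z"] by (simp add: a_def norm_mult norm_power)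
  have b: "b sums exp (of_real (- 1 / 2) * z\<^sup>2)"
    unfolding b_def d_def by (rule sums_exp_mult_square)
  have "(\<lambda>j. norm (b j)) = (\<lambda>j. of_real (if even j then (1 / 2) ^ (j div 2) / fact (j div 2) else 0) * norm z ^ j)"
    by (auto simp: b_def d_def norm_mult norm_power norm_divide power_divide fun_eq_iff)
  then have nb: "(\<lambda>j. norm (b j)) sums exp ((norm z)\<^sup>2 / 2)"
    using sums_exp_mult_square[of "1 / 2" "norm z"] by simp
  have ab: "z ^ m / fact m * of_real (poly (He m) x) = (\<Sum>i\<le>m. a i * b (m - i))" for m
  proof -
    have "z ^ m / fact m * of_real (poly (He m) x) = z ^ m * of_real (poly (He m) x / fact m)"
      by simp
    also have "\<dots> = (\<Sum>i\<le>m. z ^ m * of_real (x ^ i / fact i * d (m - i)))"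
      unfolding He_cauchy_product d_def of_real_sum sum_distrib_left ..
    also have "\<dots> = (\<Sum>i\<le>m. a i * b (m - i))"
      by (intro sum.cong refl)
        (auto simp: a_def b_def power_mult_distrib scaleR_conv_of_real field_simps simp flip: power_add)
    finally show ?thesis .
  qed
  have "(\<lambda>m. \<Sum>i\<le>m. a i * b (m - i)) sums (suminf a * suminf b)"
    by (rule Cauchy_product_sums) (use na nb in \<open>auto simp: sums_iff\<close>)
  moreover have "exp (of_real x * z - z\<^sup>2 / 2) = exp (of_real x * z) * exp (of_real (- 1 / 2) * z\<^sup>2)"
    by (simp flip: exp_add)
  ultimately show "(\<lambda>m. z ^ m / fact m * of_real (poly (He m) x)) sums exp (of_real x * z - z\<^sup>2 / 2)"
    using a b unfolding ab by (simp add: sums_iff)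
  have "(\<lambda>m. \<Sum>i\<le>m. norm (a i) * norm (b (m - i))) sums
      ((\<Sum>i. norm (a i)) * (\<Sum>j. norm (b j)))"
    by (rule Cauchy_product_sums) (use na nb in \<open>auto simp: sums_iff\<close>)
  then have *: "(\<lambda>m. \<Sum>i\<le>m. norm (a i) * norm (b (m - i))) sums exp (\<bar>x\<bar> * norm z + (norm z)\<^sup>2 / 2)"
    using na nb by (simp add: sums_iff exp_add)
  have "norm (\<Sum>m<N. z ^ m / fact m * of_real (poly (He m) x)) \<le>
      (\<Sum>m<N. \<Sum>i\<le>m. norm (a i) * norm (b (m - i)))"
    unfolding ab by (intro order_trans[OF norm_sum] sum_mono) (simp add: norm_mult[symmetric] norm_sum)
  also have "\<dots> \<le> (\<Sum>m. \<Sum>i\<le>m. norm (a i) * norm (b (m - i)))"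
    using * by (intro sum_le_suminf) (auto simp: sums_iff intro!: sum_nonneg)
  also have "\<dots> = exp (\<bar>x\<bar> * norm z + (norm z)\<^sup>2 / 2)"
    using * by (simp add: sums_iff)
  finally show "norm (\<Sum>m<N. z ^ m / fact m * of_real (poly (He m) x)) \<le> exp (\<bar>x\<bar> * norm z + (norm z)\<^sup>2 / 2)" .
qed

lemma abs_power_le_exp: "\<bar>x\<bar> ^ n \<le> fact n * exp \<bar>x :: real\<bar>"
proof -
  have "(\<Sum>k\<in>{n}. \<bar>x\<bar> ^ k /\<^sub>R fact k) \<le> (\<Sum>k. \<bar>x\<bar> ^ k /\<^sub>R fact k)"
    using exp_converges[of "\<bar>x\<bar>"] by (intro sum_le_suminf) (auto simp: sums_iff)
  also have "\<dots> = exp \<bar>x\<bar>"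
    using exp_converges[of "\<bar>x\<bar>"] by (simp add: sums_iff)
  finally show ?thesis by (simp add: field_simps)
qed

text \<open>Reduces the integrability of polynomials to that of one exponential.\<close>

lemma abs_poly_le_exp: "\<exists>C. \<forall>x::real. \<bar>poly p x\<bar> \<le> C * exp \<bar>x\<bar>"
proof -
  have "\<bar>poly p x\<bar> \<le> (\<Sum>i\<le>degree p. \<bar>coeff p i\<bar> * fact i) * exp \<bar>x\<bar>" for x
    unfolding poly_altdef sum_distrib_right
    by (intro order_trans[OF sum_abs] sum_mono)
      (auto simp: abs_mult power_abs mult.assoc intro!: mult_left_mono abs_power_le_exp)
  then show ?thesis by blast
qed

subsection \<open>Hermite polynomials and the normal distribution\<close>

lemma poly_borel_measurable [measurable]: "poly (p :: real poly) \<in> borel_measurable borel"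
  by (intro borel_measurable_continuous_onI continuous_intros)

interpretation std_normal: prob_space std_normal_distribution
  using prob_space_normal_density by simp

lemma integrable_std_normal_exp: "integrable std_normal_distribution (\<lambda>x. exp (t * \<bar>x\<bar>))"
proof (rule Bochner_Integration.integrable_bound)
  have *: "integrable std_normal_distribution (\<lambda>x. exp (s * x))" for s :: real
  proof -
    \<comment> \<open>Completing the square: tilting by \<open>exp (s x)\<close> moves the mean to
      \<open>s\<close>, up to a constant.\<close>
    have "std_normal_density x * exp (s * x) = exp (s\<^sup>2 / 2) * normal_density s 1 x" for x
      by (simp add: normal_density_def power2_eq_square field_simps flip: exp_add)
    then show ?thesis
      by (subst integrable_density) (auto simp: normal_density_nonneg)
  qed
  show "integrable std_normal_distribution (\<lambda>x. exp (t * x) + exp (- t * x))"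
    by (intro Bochner_Integration.integrable_add *)
  show "AE x in std_normal_distribution. norm (exp (t * \<bar>x\<bar>)) \<le> norm (exp (t * x) + exp (- t * x))"
  proof (intro AE_I2)
    fix x
    have "exp (t * \<bar>x\<bar>) \<le> exp (t * x) + exp (- t * x)" by (cases "x \<ge> 0") auto
    then show "norm (exp (t * \<bar>x\<bar>)) \<le> norm (exp (t * x) + exp (- t * x))" by simp
  qed
qed auto

lemma integrable_std_normal_poly: "integrable std_normal_distribution (poly p)"
proof -
  have "poly p = (\<lambda>x. \<Sum>i\<le>degree p. coeff p i * x ^ i)"
    by (simp add: poly_altdef fun_eq_iff)
  then show ?thesis
    by (simp add: integrable_std_normal_distribution_moment)
qed

lemma integrable_std_normal_poly_mult:
  "integrable std_normal_distribution (\<lambda>x. poly p x * poly q x)"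
proof -
  have "poly (p * q) = (\<lambda>x. poly p x * poly q x)" by (simp add: fun_eq_iff)
  then show ?thesis using integrable_std_normal_poly[of "p * q"] by (simp only:)
qed

text \<open>Gaussian integration by parts for monomials, read off from the explicit moments. For
  even \<open>k\<close> both sides vanish by symmetry or through the factor
  \<open>k = 0\<close>.\<close>

lemma std_normal_moment_rec:
  "(LINT x|std_normal_distribution. x ^ Suc k) = real k * (LINT x|std_normal_distribution. x ^ (k - 1))"
proof (cases "even k")
  case True
  show ?thesis
  proof (cases "k = 0")
    case False
    then show ?thesis
      using True integral_std_normal_distribution_moment_odd[of "Suc k"]
        integral_std_normal_distribution_moment_odd[of "k - 1"] by simp
  qed (use integral_std_normal_distribution_moment_odd[of 1] in simp)
next
  case False
  then obtain j where k: "k = 2 * j + 1" by (elim oddE)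
  have "(LINT x|std_normal_distribution. x ^ (2 * Suc j)) =
      fact (2 * Suc j) / (2 ^ Suc j * fact (Suc j))"
    by (rule std_normal_distribution_even_moments(1))
  also have "\<dots> = real k * (fact (2 * j) / (2 ^ j * fact j))"
  proof -
    have "1 + real j \<noteq> 0" by linarith
    then show ?thesis by (simp add: k divide_simps)
  qed
  also have "fact (2 * j) / (2 ^ j * fact j) = (LINT x|std_normal_distribution. x ^ (2 * j))"
    by (rule std_normal_distribution_even_moments(1)[symmetric])
  finally show ?thesis by (simp add: k)
qed

text \<open>Stein's identity, extended linearly from monomials.\<close>

lemma std_normal_Stein_poly:
  "(LINT x|std_normal_distribution. x * poly p x) = (LINT x|std_normal_distribution. poly (pderiv p) x)"
proof -
  have "(LINT x|std_normal_distribution. x * poly p x) =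
    (LINT x|std_normal_distribution. (\<Sum>i\<le>degree p. coeff p i * x ^ Suc i))"
    by (intro Bochner_Integration.integral_cong refl)
      (simp add: poly_altdef sum_distrib_left mult_ac)
  also have "\<dots> = (\<Sum>i\<le>degree p. coeff p i * (real i * (LINT x|std_normal_distribution. x ^ (i - 1))))"
    by (subst Bochner_Integration.integral_sum)
      (auto simp: integrable_std_normal_distribution_moment std_normal_moment_rec simp del: power_Suc)
  \<comment> \<open>The constant term drops out through its factor \<open>real i\<close>, and the
    shift produces the coefficients of \<open>pderiv p\<close>.\<close>
  also have "\<dots> = (\<Sum>i<degree p. coeff p (Suc i) * (real (Suc i) * (LINT x|std_normal_distribution. x ^ i)))"
    by (cases "degree p") (simp_all only: sum.atMost_Suc_shift lessThan_Suc_atMost, simp_all)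
  also have "\<dots> = (LINT x|std_normal_distribution. (\<Sum>i<degree p. coeff (pderiv p) i * x ^ i))"
    by (subst Bochner_Integration.integral_sum)
      (auto simp: integrable_std_normal_distribution_moment coeff_pderiv mult_ac)
  also have "\<dots> = (LINT x|std_normal_distribution. poly (pderiv p) x)"
  proof (intro Bochner_Integration.integral_cong refl)
    fix x
    show "(\<Sum>i<degree p. coeff (pderiv p) i * x ^ i) = poly (pderiv p) x"
    proof (cases "degree p = 0")
      case True
      then have "pderiv p = 0" by (simp add: pderiv_eq_0_iff)
      then show ?thesis by simp
    next
      case False
      then have "{..<degree p} = {..degree (pderiv p)}" by (auto simp: degree_pderiv)
      then show ?thesis by (simp add: poly_altdef)
    qed
  qed
  finally show ?thesis .
qed

text \<open>By Stein's identity the raising operator is adjoint to differentiation, so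
  \<open>raise\<close> lowers both indices at the cost of a factor \<open>l\<close>, until one of
  them is 0.\<close>

lemma He_orthogonal:
  "(LINT x|std_normal_distribution. poly (He m) x * poly (He l) x) = (if m = l then fact m else 0)"
proof -
  have raise: "(LINT x|std_normal_distribution. poly (He (Suc m)) x * poly (He l) x) =
      real l * (LINT x|std_normal_distribution. poly (He m) x * poly (He (l - 1)) x)" for m l
  proof -
    have "(LINT x|std_normal_distribution. poly (He (Suc m)) x * poly (He l) x) =
      (LINT x|std_normal_distribution. x * poly (He m * He l) x - poly (pderiv (He m) * He l) x)"
      by (simp add: He.simps(2) algebra_simps)
    also have "\<dots> = (LINT x|std_normal_distribution. x * poly (He m * He l) x)
        - (LINT x|std_normal_distribution. poly (pderiv (He m) * He l) x)"
      using integrable_std_normal_poly_mult[of "[:0, 1:]" "He m * He l"]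
      by (intro Bochner_Integration.integral_diff integrable_std_normal_poly) simp
    also have "\<dots> = (LINT x|std_normal_distribution. poly (pderiv (He m * He l)) x - poly (pderiv (He m) * He l) x)"
      by (simp only: std_normal_Stein_poly) 
        (intro Bochner_Integration.integral_diff[symmetric] integrable_std_normal_poly)
    also have "\<dots> = (LINT x|std_normal_distribution. real l * (poly (He m) x * poly (He (l - 1)) x))"
      by (cases l) (simp_all add: pderiv_mult pderiv_He algebra_simps)
    finally show ?thesis by simp
  qed
  show ?thesis
  proof (induction m arbitrary: l)
    case 0
    show ?case
    proof (cases l)
      case (Suc k)
      have "(LINT x|std_normal_distribution. poly (He (Suc k)) x * poly (He 0) x) = 0"
        by (subst raise) simp
      then show ?thesis by (simp add: Suc)
    qed (simp add: std_normal.prob_space[simplified])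
  next
    case (Suc m)
    show ?case using raise[of m l] by (cases l) (simp_all add: Suc)
  qed
qed

section \<open>Square-integrable functions: Cauchy--Schwarz, Bessel and Riesz--Fischer\<close>

lemma integrable_mult_square_integrable:
  fixes u v :: "'a \<Rightarrow> real"
  assumes [measurable]: "u \<in> borel_measurable M" "v \<in> borel_measurable M"
    and "integrable M (\<lambda>x. (u x)\<^sup>2)" "integrable M (\<lambda>x. (v x)\<^sup>2)"
  shows "integrable M (\<lambda>x. u x * v x)"
proof (rule Bochner_Integration.integrable_bound)
  show "integrable M (\<lambda>x. (u x)\<^sup>2 + (v x)\<^sup>2)"
    using assms by simp
  have "\<bar>u x * v x\<bar> \<le> (u x)\<^sup>2 + (v x)\<^sup>2" for x
  proof -
    have "2 * (\<bar>u x\<bar> * \<bar>v x\<bar>) \<le> (u x)\<^sup>2 + (v x)\<^sup>2"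
      using zero_le_power2[of "\<bar>u x\<bar> - \<bar>v x\<bar>"] by (simp add: power2_diff)
    moreover have "0 \<le> \<bar>u x\<bar> * \<bar>v x\<bar>" by simp
    ultimately show ?thesis by (simp only: abs_mult)
  qed
  then show "AE x in M. norm (u x * v x) \<le> norm ((u x)\<^sup>2 + (v x)\<^sup>2)"
    by simp
qed simp

text \<open>The integral of \<open>(s u + t v)^2\<close> is a nonnegative quadratic form in
  \<open>s\<close> and \<open>t\<close>; suitable values of these give the inequality.\<close>

lemma Cauchy_Schwarz_lebesgue:
  fixes u v :: "'a \<Rightarrow> real"
  assumes [measurable]: "u \<in> borel_measurable M" "v \<in> borel_measurable M"
    and u: "integrable M (\<lambda>x. (u x)\<^sup>2)" and v: "integrable M (\<lambda>x. (v x)\<^sup>2)"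
  shows "(\<integral>x. u x * v x \<partial>M)\<^sup>2 \<le> (\<integral>x. (u x)\<^sup>2 \<partial>M) * (\<integral>x. (v x)\<^sup>2 \<partial>M)"
proof -
  let ?A = "\<integral>x. (u x)\<^sup>2 \<partial>M" and ?B = "\<integral>x. u x * v x \<partial>M" and ?C = "\<integral>x. (v x)\<^sup>2 \<partial>M"
  note uv = integrable_mult_square_integrable[OF assms]
  have *: "0 \<le> s\<^sup>2 * ?A + 2 * s * t * ?B + t\<^sup>2 * ?C" for s t
  proof -
    have "0 \<le> (\<integral>x. (s * u x + t * v x)\<^sup>2 \<partial>M)" by simp
    also have "\<dots> = (\<integral>x. s\<^sup>2 * (u x)\<^sup>2 + 2 * s * t * (u x * v x) + t\<^sup>2 * (v x)\<^sup>2 \<partial>M)"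
      by (intro Bochner_Integration.integral_cong refl) (simp add: power2_eq_square algebra_simps)
    also have "\<dots> = s\<^sup>2 * ?A + 2 * s * t * ?B + t\<^sup>2 * ?C"
      using u v uv by simp
    finally show ?thesis .
  qed
  have "0 \<le> ?C" by simp
  show ?thesis
  proof (cases "?C = 0")
    case True
    have "?B = 0"
    proof (rule ccontr)
      assume "?B \<noteq> 0"
      \<comment> \<open>With \<open>?C = 0\<close> this choice makes the quadratic form at
        \<open>(1, t)\<close> equal to -1.\<close>
      define t where "t = - (?A + 1) / (2 * ?B)"
      have "2 * t * ?B = - (?A + 1)"
        using \<open>?B \<noteq> 0\<close> by (simp add: t_def)
      then show False
        using *[of 1 t] True by simp
    qed
    then show ?thesis by simp
  next
    case False
    with \<open>0 \<le> ?C\<close> have "0 < ?C" by linarith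
    \<comment> \<open>The minimiser in direction \<open>v\<close>, scaled by \<open>?C\<close> to
      avoid a division.\<close>
    have "0 \<le> ?C * (?A * ?C - ?B\<^sup>2)"
      using *[of ?C "- ?B"] by (simp add: power2_eq_square algebra_simps)
    then show ?thesis using \<open>0 < ?C\<close> by (simp add: zero_le_mult_iff)
  qed
qed

text \<open>Pythagoras: orthogonality kills the mixed terms, and the squared norm
  \<open>fact m\<close> of \<open>He m\<close> cancels one factorial.\<close>

lemma He_sum_square:
  assumes "finite A"
  shows "integrable std_normal_distribution (\<lambda>x. (\<Sum>m\<in>A. c m / fact m * poly (He m) x)\<^sup>2)"
    and "(LINT x|std_normal_distribution. (\<Sum>m\<in>A. c m / fact m * poly (He m) x)\<^sup>2) = (\<Sum>m\<in>A. (c m)\<^sup>2 / fact m)"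
proof -
  have eq: "(\<lambda>x. (\<Sum>m\<in>A. c m / fact m * poly (He m) x)\<^sup>2) =
    (\<lambda>x. \<Sum>m\<in>A. \<Sum>l\<in>A. (c m / fact m) * (c l / fact l) * (poly (He m) x * poly (He l) x))"
    by (simp add: fun_eq_iff power2_eq_square sum_product mult_ac)
  show "integrable std_normal_distribution (\<lambda>x. (\<Sum>m\<in>A. c m / fact m * poly (He m) x)\<^sup>2)"
    unfolding eq by (intro Bochner_Integration.integrable_sum integrable_mult_right integrable_std_normal_poly_mult)
  have "(LINT x|std_normal_distribution. (\<Sum>m\<in>A. c m / fact m * poly (He m) x)\<^sup>2) =
    (\<Sum>m\<in>A. \<Sum>l\<in>A. (c m / fact m) * (c l / fact l) * (if m = l then fact m else 0))"
    unfolding eq He_orthogonal[symmetric]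
    by (subst Bochner_Integration.integral_sum Bochner_Integration.integral_mult_right
        | intro sum.cong refl Bochner_Integration.integrable_sum integrable_mult_right integrable_std_normal_poly_mult)+
  also have "\<dots> = (\<Sum>m\<in>A. (c m)\<^sup>2 / fact m)"
    using assms by (intro sum.cong refl) (simp add: if_distrib[of "\<lambda>t. _ * t"] sum.delta power2_eq_square cong: if_cong)
  finally show "(LINT x|std_normal_distribution. (\<Sum>m\<in>A. c m / fact m * poly (He m) x)\<^sup>2) = (\<Sum>m\<in>A. (c m)\<^sup>2 / fact m)" .
qed

lemma integrable_std_normal_poly_square: "integrable std_normal_distribution (\<lambda>x. (poly p x)\<^sup>2)"
  unfolding power2_eq_square by (rule integrable_std_normal_poly_mult)

text \<open>Expand the nonnegative squared distance between \<open>u\<close> and its projection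
  \<open>?f\<close> onto the chosen Hermite polynomials.\<close>

lemma He_Bessel:
  assumes "finite A" and [measurable]: "u \<in> borel_measurable borel"
    and u: "integrable std_normal_distribution (\<lambda>x. (u x)\<^sup>2)"
  shows "(\<Sum>m\<in>A. (LINT x|std_normal_distribution. u x * poly (He m) x)\<^sup>2 / fact m) \<le>
    (LINT x|std_normal_distribution. (u x)\<^sup>2)"
proof -
  define c where "c = (\<lambda>m. LINT x|std_normal_distribution. u x * poly (He m) x)"
  let ?f = "\<lambda>x. \<Sum>m\<in>A. c m / fact m * poly (He m) x"
  have uH: "integrable std_normal_distribution (\<lambda>x. u x * poly p x)" for p
    by (rule integrable_mult_square_integrable) (auto simp: u integrable_std_normal_poly_square)
  have eq: "(\<lambda>x. u x * ?f x) = (\<lambda>x. \<Sum>m\<in>A. c m / fact m * (u x * poly (He m) x))"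
    by (simp add: fun_eq_iff sum_distrib_left mult_ac)
  have uf: "integrable std_normal_distribution (\<lambda>x. u x * ?f x)"
    unfolding eq by (intro Bochner_Integration.integrable_sum integrable_mult_right uH)
  have uf': "(LINT x|std_normal_distribution. u x * ?f x) = (\<Sum>m\<in>A. (c m)\<^sup>2 / fact m)"
    unfolding eq by (subst Bochner_Integration.integral_sum) (auto simp: uH power2_eq_square c_def)
  have "0 \<le> (LINT x|std_normal_distribution. (u x - ?f x)\<^sup>2)" by simp
  also have "\<dots> = (LINT x|std_normal_distribution. (u x)\<^sup>2 - 2 * (u x * ?f x) + (?f x)\<^sup>2)"
    by (intro Bochner_Integration.integral_cong refl) (simp add: power2_diff)
  also have "\<dots> = (LINT x|std_normal_distribution. (u x)\<^sup>2) - 2 * (LINT x|std_normal_distribution. u x * ?f x)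
      + (LINT x|std_normal_distribution. (?f x)\<^sup>2)"
    using u uf He_sum_square(1)[OF assms(1), of c] by simp
  also have "\<dots> = (LINT x|std_normal_distribution. (u x)\<^sup>2) - (\<Sum>m\<in>A. (c m)\<^sup>2 / fact m)"
    unfolding uf' He_sum_square(2)[OF assms(1)] by simp
  finally show ?thesis by (simp add: c_def)
qed

text \<open>Turns smallness in the mean square into smallness in the mean over a probability
  measure.\<close>

lemma abs_le_of_square: "e > 0 \<Longrightarrow> \<bar>x :: real\<bar> \<le> e / 2 + x\<^sup>2 / (2 * e)"
proof -
  assume e: "e > 0"
  have "2 * \<bar>x\<bar> * e \<le> e\<^sup>2 + x\<^sup>2"
    using zero_le_power2[of "\<bar>x\<bar> - e"] by (simp add: power2_diff)
  then show ?thesis using e by (simp add: field_simps power2_eq_square)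
qed

text \<open>The partial sums \<open>f N\<close> are Cauchy in mean, so a subsequence converges
  almost everywhere to some \<open>g\<close>. Fatou's lemma bounds the squared distance from
  \<open>g\<close> to \<open>f K\<close> by the tail \<open>T K\<close>: \<open>K = 0\<close> gives
  square integrability, \<open>K = 1\<close> the last claim, and large \<open>K\<close> the
  coefficients.\<close>

lemma He_Riesz_Fischer:
  assumes a: "summable (\<lambda>m. (a m)\<^sup>2 / fact m)"
  obtains g where "g \<in> borel_measurable borel"
    "integrable std_normal_distribution (\<lambda>x. (g x)\<^sup>2)"
    "\<forall>m. (LINT x|std_normal_distribution. g x * poly (He m) x) = a m"
    "(\<integral>\<^sup>+x. ennreal ((g x - a 0)\<^sup>2) \<partial>std_normal_distribution) \<le> ennreal (\<Sum>m. (a (Suc m))\<^sup>2 / fact (Suc m))"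
proof -
  define T where "T = (\<lambda>N. \<Sum>m. (a (m + N))\<^sup>2 / fact (m + N))"
  define f where "f = (\<lambda>N x. \<Sum>m<N. a m / fact m * poly (He m) x)"
  have f_meas [measurable]: "f N \<in> borel_measurable borel" for N
    unfolding f_def by measurable
  have diff: "f N x - f K x = (\<Sum>m\<in>{K..<N}. a m / fact m * poly (He m) x)" if "K \<le> N" for K N x
  proof -
    have "{..<N} - {..<K} = {K..<N}" by auto
    then show ?thesis unfolding f_def using that by (subst sum_diff[symmetric]) auto
  qed
  have T0: "T \<longlonglongrightarrow> 0"
    unfolding T_def using suminf_exist_split2[OF a] .
  have f2: "integrable std_normal_distribution (\<lambda>x. (f N x - f K x)\<^sup>2)"
    "(LINT x|std_normal_distribution. (f N x - f K x)\<^sup>2) \<le> T K" if "K \<le> N" for K N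
  proof -
    show "integrable std_normal_distribution (\<lambda>x. (f N x - f K x)\<^sup>2)"
      unfolding diff[OF that] by (rule He_sum_square) simp
    have "(LINT x|std_normal_distribution. (f N x - f K x)\<^sup>2) = (\<Sum>m\<in>{K..<N}. (a m)\<^sup>2 / fact m)"
      unfolding diff[OF that] by (rule He_sum_square) simp
    also have "\<dots> = (\<Sum>m<N - K. (a (m + K))\<^sup>2 / fact (m + K))"
      by (rule sum.reindex_bij_witness[of _ "\<lambda>m. m + K" "\<lambda>m. m - K"]) (use that in auto)
    also have "\<dots> \<le> T K"
      unfolding T_def using summable_ignore_initial_segment[OF a, of K] by (intro sum_le_suminf) auto
    finally show "(LINT x|std_normal_distribution. (f N x - f K x)\<^sup>2) \<le> T K" .
  qed
  have f1: "integrable std_normal_distribution (f N)" for N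
    unfolding f_def by (intro Bochner_Integration.integrable_sum integrable_mult_right integrable_std_normal_poly)
  have "\<exists>N. \<forall>i\<ge>N. \<forall>j\<ge>N. (LINT x|std_normal_distribution. norm (f i x - f j x)) < e" if e: "e > 0" for e
  proof -
    \<comment> \<open>The threshold \<open>e^2\<close> makes the two halves of
      \<open>abs_le_of_square\<close> add up to \<open>e\<close>.\<close>
    have "eventually (\<lambda>N. T N < e\<^sup>2) sequentially"
      using T0 e by (intro order_tendstoD) auto
    then obtain N where N: "\<And>K. K \<ge> N \<Longrightarrow> T K < e\<^sup>2" by (auto simp: eventually_sequentially)
    have L: "(LINT x|std_normal_distribution. norm (f i x - f j x)) < e" if "j \<ge> N" "j \<le> i" for i j
    proof -
      have "(LINT x|std_normal_distribution. norm (f i x - f j x)) \<le>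
        (LINT x|std_normal_distribution. e / 2 + (f i x - f j x)\<^sup>2 / (2 * e))"
        using f1 f2(1)[OF that(2)] abs_le_of_square[OF e]
        by (intro Bochner_Integration.integral_mono) auto
      also have "\<dots> = e / 2 + (LINT x|std_normal_distribution. (f i x - f j x)\<^sup>2) / (2 * e)"
        using f2(1)[OF that(2)] by (simp add: std_normal.prob_space[simplified])
      also have "\<dots> < e / 2 + e\<^sup>2 / (2 * e)"
        using f2(2)[OF that(2)] N[OF that(1)] e by (simp add: divide_strict_right_mono)
      also have "\<dots> = e" using e by (simp add: power2_eq_square)
      finally show ?thesis .
    qed
    show ?thesis
    proof (intro exI[of _ N] allI impI)
      fix i j assume "i \<ge> N" "j \<ge> N"
      then show "(LINT x|std_normal_distribution. norm (f i x - f j x)) < e"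
        using L[of i j] L[of j i] by (cases "i \<le> j") (auto simp: abs_minus_commute)
    qed
  qed
  from cauchy_L1_AE_cauchy_subseq[OF f1 this] obtain r where r: "strict_mono r"
    "AE x in std_normal_distribution. Cauchy (\<lambda>i. f (r i) x)" by blast
  define g where "g = (\<lambda>x. lim (\<lambda>i. f (r i) x))"
  have g_meas [measurable]: "g \<in> borel_measurable borel"
    unfolding g_def by measurable
  have lim: "AE x in std_normal_distribution. (\<lambda>i. f (r i) x) \<longlonglongrightarrow> g x"
    using r(2) by eventually_elim (simp add: g_def Cauchy_convergent_iff convergent_LIMSEQ_iff)
  have gf: "(\<integral>\<^sup>+x. ennreal ((g x - f K x)\<^sup>2) \<partial>std_normal_distribution) \<le> ennreal (T K)" for K
  proof -
    have "(\<integral>\<^sup>+x. ennreal ((g x - f K x)\<^sup>2) \<partial>std_normal_distribution) =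
      (\<integral>\<^sup>+x. liminf (\<lambda>i. ennreal ((f (r i) x - f K x)\<^sup>2)) \<partial>std_normal_distribution)"
    proof (rule nn_integral_cong_AE)
      show "AE x in std_normal_distribution. ennreal ((g x - f K x)\<^sup>2) = liminf (\<lambda>i. ennreal ((f (r i) x - f K x)\<^sup>2))"
        using lim
      proof eventually_elim
        case (elim x)
        have "(\<lambda>i. ennreal ((f (r i) x - f K x)\<^sup>2)) \<longlonglongrightarrow> ennreal ((g x - f K x)\<^sup>2)"
          by (intro tendsto_intros tendsto_ennrealI elim)
        then show ?case by (intro lim_imp_Liminf[symmetric]) auto
      qed
    qed
    also have "\<dots> \<le> liminf (\<lambda>i. \<integral>\<^sup>+x. ennreal ((f (r i) x - f K x)\<^sup>2) \<partial>std_normal_distribution)"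
      by (rule nn_integral_liminf) auto
    also have "\<dots> \<le> liminf (\<lambda>i. ennreal (T K))"
    proof (rule Liminf_mono)
      show "eventually (\<lambda>i. (\<integral>\<^sup>+x. ennreal ((f (r i) x - f K x)\<^sup>2) \<partial>std_normal_distribution) \<le> ennreal (T K)) sequentially"
        using eventually_ge_at_top[of K]
      proof eventually_elim
        case (elim i)
        then have "K \<le> r i" using strict_mono_imp_increasing[OF r(1), of i] by simp
        from f2[OF this] show ?case
          by (subst nn_integral_eq_integral) (auto intro!: ennreal_leI)
      qed
    qed
    also have "\<dots> = ennreal (T K)" by (simp add: Liminf_const)
    finally show ?thesis .
  qed
  have T_nonneg: "0 \<le> T K" for K
    unfolding T_def using summable_ignore_initial_segment[OF a, of K] by (intro suminf_nonneg) auto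
  have gf_int: "integrable std_normal_distribution (\<lambda>x. (g x - f K x)\<^sup>2)" for K
    using le_less_trans[OF gf[of K] ennreal_less_top]
    by (intro integrableI_nonneg) (auto simp: less_top)
  have gf2: "(LINT x|std_normal_distribution. (g x - f K x)\<^sup>2) \<le> T K" for K
    using gf[of K] by (subst (asm) nn_integral_eq_integral[OF gf_int]) (auto simp: T_nonneg)
  have g2: "integrable std_normal_distribution (\<lambda>x. (g x)\<^sup>2)"
    using gf_int[of 0] by (simp add: f_def)
  have coeff: "(LINT x|std_normal_distribution. g x * poly (He m) x) = a m" for m
  proof -
    let ?d = "(LINT x|std_normal_distribution. g x * poly (He m) x) - a m"
    have gH: "integrable std_normal_distribution (\<lambda>x. g x * poly (He m) x)"
      by (rule integrable_mult_square_integrable) (auto simp: g2 integrable_std_normal_poly_square)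
    \<comment> \<open>For \<open>m < K\<close> the partial sum \<open>f K\<close> already has
      coefficient \<open>a m\<close>, so \<open>?d\<close> is the coefficient of
      \<open>g - f K\<close> and Cauchy--Schwarz applies.\<close>
    have "?d\<^sup>2 \<le> T K * fact m" if "m < K" for K
    proof -
      have fH_eq: "(\<lambda>x. f K x * poly (He m) x) = (\<lambda>x. \<Sum>l<K. a l / fact l * (poly (He l) x * poly (He m) x))"
        by (simp add: f_def sum_distrib_left sum_distrib_right mult_ac)
      have fH: "integrable std_normal_distribution (\<lambda>x. f K x * poly (He m) x)"
        unfolding fH_eq by (intro Bochner_Integration.integrable_sum integrable_mult_right integrable_std_normal_poly_mult)
      have "(LINT x|std_normal_distribution. f K x * poly (He m) x) = (\<Sum>l<K. a l / fact l * (if l = m then fact l else 0))"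
        unfolding fH_eq He_orthogonal[symmetric]
        by (subst Bochner_Integration.integral_sum) (auto simp: integrable_std_normal_poly_mult)
      also have "\<dots> = a m"
        using that by (simp add: if_distrib[of "\<lambda>t. _ * t"] sum.delta cong: if_cong)
      finally have "?d = (LINT x|std_normal_distribution. (g x - f K x) * poly (He m) x)"
        using gH fH by (simp add: left_diff_distrib)
      then have "?d\<^sup>2 \<le> (LINT x|std_normal_distribution. (g x - f K x)\<^sup>2) * (LINT x|std_normal_distribution. (poly (He m) x)\<^sup>2)"
        by (simp only:) (intro Cauchy_Schwarz_lebesgue gf_int integrable_std_normal_poly_square; measurable)
      also have "\<dots> \<le> T K * fact m"
        using He_orthogonal[of m m] by (intro mult_mono gf2 T_nonneg) (auto simp: power2_eq_square)
      finally show ?thesis .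
    qed
    moreover have "(\<lambda>K. T K * fact m) \<longlonglongrightarrow> 0 * fact m"
      by (intro tendsto_mult T0 tendsto_const)
    ultimately have "?d\<^sup>2 \<le> 0 * fact m"
      by (intro tendsto_lowerbound[where F = sequentially and f = "\<lambda>K. T K * fact m"])
        (auto simp: eventually_sequentially intro!: exI[of _ "Suc m"])
    then show ?thesis by simp
  qed
  have "(\<integral>\<^sup>+x. ennreal ((g x - a 0)\<^sup>2) \<partial>std_normal_distribution) \<le> ennreal (\<Sum>m. (a (Suc m))\<^sup>2 / fact (Suc m))"
    using gf[of 1] by (simp add: f_def T_def)
  then show ?thesis
    using that[OF g_meas g2] coeff by blast
qed

section \<open>Hermite moments and Fourier transforms\<close>

lemma integrable_poly_of_exp:
  fixes w Y :: "'a \<Rightarrow> real"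
  assumes [measurable]: "w \<in> borel_measurable N" "Y \<in> borel_measurable N"
    and w: "integrable N (\<lambda>x. w x * exp \<bar>Y x\<bar>)"
  shows "integrable N (\<lambda>x. w x * poly p (Y x))"
proof -
  obtain C where C: "\<And>x. \<bar>poly p x\<bar> \<le> C * exp \<bar>x\<bar>"
    using abs_poly_le_exp by blast
  show ?thesis
  proof (rule Bochner_Integration.integrable_bound)
    show "integrable N (\<lambda>x. C * (w x * exp \<bar>Y x\<bar>))" using w by simp
    have "\<bar>w x * poly p (Y x)\<bar> \<le> \<bar>C * (w x * exp \<bar>Y x\<bar>)\<bar>" for x
    proof -
      have "\<bar>w x\<bar> * \<bar>poly p (Y x)\<bar> \<le> \<bar>w x\<bar> * \<bar>C * exp \<bar>Y x\<bar>\<bar>"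
        using C[of "Y x"] by (intro mult_left_mono) auto
      then show ?thesis by (simp add: abs_mult mult_ac)
    qed
    then show "AE x in N. norm (w x * poly p (Y x)) \<le> norm (C * (w x * exp \<bar>Y x\<bar>))" by simp
  qed simp
qed

text \<open>Integrate the generating function at \<open>z = i t\<close> term by term, by dominated
  convergence. The pair of measure and weight covers both a signed weight on \<open>lborel\<close>
  and the weight 1 on a law.\<close>

lemma Fourier_transform_He_moments:
  fixes w :: "real \<Rightarrow> real"
  assumes [measurable_cong]: "sets N = sets borel" and [measurable]: "w \<in> borel_measurable borel"
    and w: "\<And>t. integrable N (\<lambda>x. w x * exp (t * \<bar>x\<bar>))"
  shows "(\<lambda>m. (\<i> * of_real t) ^ m / fact m * of_real (\<integral>x. w x * poly (He m) x \<partial>N)) sums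
    (of_real (exp (t\<^sup>2 / 2)) * (CLINT x|N. of_real (w x) * iexp (t * x)))"
proof -
  let ?z = "\<i> * complex_of_real t"
  define s where "s = (\<lambda>K x. \<Sum>m<K. ?z ^ m / fact m * of_real (w x * poly (He m) x))"
  have wH: "integrable N (\<lambda>x. w x * poly p x)" for p
    using w[of 1] by (intro integrable_poly_of_exp) auto
  have s_eq: "s K x = of_real (w x) * (\<Sum>m<K. ?z ^ m / fact m * of_real (poly (He m) x))" for K x
    by (simp add: s_def sum_distrib_left mult_ac)
  have lim: "(\<lambda>K. integral\<^sup>L N (s K)) \<longlonglongrightarrow> (CLINT x|N. of_real (exp (t\<^sup>2 / 2)) * (of_real (w x) * iexp (t * x)))"
  proof (rule integral_dominated_convergence)
    show "integrable N (\<lambda>x. exp (t\<^sup>2 / 2) * \<bar>w x * exp (\<bar>t\<bar> * \<bar>x\<bar>)\<bar>)"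
      by (intro integrable_mult_right integrable_abs w)
    show "AE x in N. (\<lambda>K. s K x) \<longlonglongrightarrow> of_real (exp (t\<^sup>2 / 2)) * (of_real (w x) * iexp (t * x))"
    proof (intro AE_I2)
      fix x
      have "(\<lambda>K. \<Sum>m<K. ?z ^ m / fact m * of_real (poly (He m) x)) \<longlonglongrightarrow> exp (of_real x * ?z - ?z\<^sup>2 / 2)"
        using He_generating_function(1)[of ?z x] by (simp add: sums_def)
      moreover have "exp (of_real x * ?z - ?z\<^sup>2 / 2) = of_real (exp (t\<^sup>2 / 2)) * iexp (t * x)"
        by (simp add: power_mult_distrib exp_add[symmetric] exp_of_real[symmetric] mult_ac add_ac)
      ultimately have "(\<lambda>K. s K x) \<longlonglongrightarrow> of_real (w x) * (of_real (exp (t\<^sup>2 / 2)) * iexp (t * x))"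
        unfolding s_eq by (intro tendsto_mult tendsto_const) simp
      then show "(\<lambda>K. s K x) \<longlonglongrightarrow> of_real (exp (t\<^sup>2 / 2)) * (of_real (w x) * iexp (t * x))"
        by (simp add: mult_ac)
    qed
    show "AE x in N. norm (s K x) \<le> exp (t\<^sup>2 / 2) * \<bar>w x * exp (\<bar>t\<bar> * \<bar>x\<bar>)\<bar>" for K
    proof (intro AE_I2)
      fix x
      have "norm (s K x) \<le> \<bar>w x\<bar> * exp (\<bar>x\<bar> * norm ?z + (norm ?z)\<^sup>2 / 2)"
        unfolding s_eq norm_mult[of "of_real (w x)"] norm_of_real
        by (intro mult_left_mono He_generating_function(2)) auto
      also have "\<dots> = exp (t\<^sup>2 / 2) * \<bar>w x * exp (\<bar>t\<bar> * \<bar>x\<bar>)\<bar>"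
        by (simp add: norm_mult exp_add abs_mult mult_ac)
      finally show "norm (s K x) \<le> exp (t\<^sup>2 / 2) * \<bar>w x * exp (\<bar>t\<bar> * \<bar>x\<bar>)\<bar>" .
    qed
  qed (unfold s_def, measurable)
  have "integral\<^sup>L N (s K) = (\<Sum>m<K. ?z ^ m / fact m * of_real (\<integral>x. w x * poly (He m) x \<partial>N))" for K
    unfolding s_def
    by (subst Bochner_Integration.integral_sum)
      (auto simp del: of_real_mult intro!: integrable_mult_right integrable_of_real wH sum.cong)
  then show ?thesis
    using lim by (simp add: sums_def)
qed

text \<open>Levy's uniqueness theorem concerns probability laws, so \<open>w\<close> is split into
  its positive and negative parts. Their transforms agree, in particular at 0, so they have a common
  mass \<open>c\<close>; either \<open>c = 0\<close> and both vanish, or division by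
  \<open>c\<close> yields two laws with one characteristic function.\<close>

lemma Fourier_transform_injective:
  fixes w :: "real \<Rightarrow> real"
  assumes w: "integrable lborel w" and F: "\<And>t. (CLINT x|lborel. of_real (w x) * iexp (t * x)) = 0"
  shows "AE x in lborel. w x = 0"
proof -
  define P where "P = (\<lambda>x. max 0 (w x))"
  define Q where "Q = (\<lambda>x. max 0 (- w x))"
  have [measurable]: "w \<in> borel_measurable borel" using w by auto
  have [measurable]: "P \<in> borel_measurable borel" "Q \<in> borel_measurable borel"
    unfolding P_def Q_def by measurable
  have P: "integrable lborel P" and Q: "integrable lborel Q"
    unfolding P_def Q_def by (intro integrable_max w integrable_zero integrable_minus)+
  have nonneg: "0 \<le> P x" "0 \<le> Q x" for x by (auto simp: P_def Q_def)
  have wPQ: "w x = P x - Q x" for x by (auto simp: P_def Q_def)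
  have int: "integrable lborel (\<lambda>x. complex_of_real (v x) * iexp (t * x))"
    if "integrable lborel v" for v t
  proof (rule Bochner_Integration.integrable_bound[OF that])
    show "(\<lambda>x. complex_of_real (v x) * iexp (t * x)) \<in> borel_measurable lborel"
      using borel_measurable_integrable[OF that] by measurable
  qed (simp add: norm_mult)
  have PQ: "(CLINT x|lborel. of_real (P x) * iexp (t * x)) = (CLINT x|lborel. of_real (Q x) * iexp (t * x))" for t
    using F[of t] int[OF P, of t] int[OF Q, of t] by (simp add: wPQ left_diff_distrib)
  define c where "c = integral\<^sup>L lborel P"
  have cQ: "c = integral\<^sup>L lborel Q"
    using PQ[of 0] by (simp add: c_def)
  have "c \<ge> 0" unfolding c_def by (simp add: nonneg)
  show ?thesis
  proof (cases "c = 0")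
    case True
    then have "AE x in lborel. P x = 0" "AE x in lborel. Q x = 0"
      using integral_nonneg_eq_0_iff_AE[OF P] integral_nonneg_eq_0_iff_AE[OF Q] cQ nonneg
      by (auto simp: c_def)
    then show ?thesis by eventually_elim (simp add: wPQ)
  next
    case False
    with \<open>c \<ge> 0\<close> have c: "c > 0" by simp
    have rd: "real_distribution (density lborel (\<lambda>x. ennreal (v x / c)))"
      and ch: "char (density lborel (\<lambda>x. ennreal (v x / c))) t = (CLINT x|lborel. of_real (v x) * iexp (t * x)) / of_real c"
      if v: "integrable lborel v" "\<And>x. 0 \<le> v x" "integral\<^sup>L lborel v = c" for v t
    proof -
      have [measurable]: "v \<in> borel_measurable borel" using v(1) by auto
      have "(\<integral>\<^sup>+x. ennreal (v x / c) \<partial>lborel) = ennreal (integral\<^sup>L lborel (\<lambda>x. v x / c))"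
        using v c by (intro nn_integral_eq_integral) auto
      then have "(\<integral>\<^sup>+x. ennreal (v x / c) \<partial>lborel) = 1"
        using v c by simp
      then have "prob_space (density lborel (\<lambda>x. ennreal (v x / c)))"
        by (intro prob_spaceI) (simp add: emeasure_density)
      then show "real_distribution (density lborel (\<lambda>x. ennreal (v x / c)))"
        by (simp add: real_distribution_def real_distribution_axioms_def)
      have "char (density lborel (\<lambda>x. ennreal (v x / c))) t = (CLINT x|lborel. (v x / c) *\<^sub>R iexp (t * x))"
        unfolding char_def using v c by (intro integral_density) auto
      also have "\<dots> = (CLINT x|lborel. (of_real (v x) * iexp (t * x)) / of_real c)"
        by (simp add: scaleR_conv_of_real)
      finally show "char (density lborel (\<lambda>x. ennreal (v x / c))) t = (CLINT x|lborel. of_real (v x) * iexp (t * x)) / of_real c"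
        by simp
    qed
    have "density lborel (\<lambda>x. ennreal (P x / c)) = density lborel (\<lambda>x. ennreal (Q x / c))"
    proof (rule Levy_uniqueness)
      show "char (density lborel (\<lambda>x. ennreal (P x / c))) = char (density lborel (\<lambda>x. ennreal (Q x / c)))"
        using P Q nonneg by (intro ext) (simp only: ch c_def[symmetric] cQ[symmetric] PQ)
    qed (simp_all add: rd P Q nonneg c_def[symmetric] cQ[symmetric])
    then have "AE x in lborel. ennreal (P x / c) = ennreal (Q x / c)"
      by (intro sigma_finite_measure.density_unique[OF sigma_finite_lborel]) auto
    then show ?thesis
      by eventually_elim (use c nonneg in \<open>simp add: wPQ ennreal_inj\<close>)
  qed
qed

subsection \<open>Chi-square distance and Hermite moments\<close>

text \<open>The density chosen inside \<open>chi2\<close> is extended-real valued. Having integral 1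
  it is finite almost everywhere, so its \<open>enn2real\<close> version is again a density, with
  the same integrand in \<open>chi2\<close>.\<close>

lemma chi2_density:
  assumes "prob_space M" "distributed M lborel Y p"
  obtains q where "q \<in> borel_measurable borel" "\<forall>x. 0 \<le> q x"
    "distributed M lborel Y (\<lambda>x. ennreal (q x))"
    "chi2 M Y = (\<integral>\<^sup>+x. ennreal ((q x / std_normal_density x - 1)\<^sup>2) \<partial>std_normal_distribution)"
proof -
  interpret prob_space M by fact
  define p0 where "p0 = (SOME p. distributed M lborel Y p)"
  have p0: "distributed M lborel Y p0"
    using someI[of "\<lambda>p. distributed M lborel Y p", OF assms(2)] by (simp only: p0_def)
  have [measurable]: "p0 \<in> borel_measurable borel"
    using distributed_borel_measurable[OF p0] by simp
  have "(\<integral>\<^sup>+x. p0 x \<partial>lborel) = 1"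
    using distributed_nn_integral[OF p0, of "\<lambda>_. 1"] by (simp add: emeasure_space_1)
  then have "AE x in lborel. p0 x \<noteq> \<infinity>"
    by (intro nn_integral_PInf_AE) auto
  then have "AE x in lborel. p0 x = ennreal (enn2real (p0 x))"
    by eventually_elim (simp add: less_top)
  then have "distributed M lborel Y (\<lambda>x. ennreal (enn2real (p0 x)))"
    using p0 by (subst (asm) distributed_cong_density) auto
  moreover have "chi2 M Y = (\<integral>\<^sup>+x. ennreal ((enn2real (p0 x) / std_normal_density x - 1)\<^sup>2) \<partial>std_normal_distribution)"
    using assms(2) unfolding chi2_def p0_def[symmetric]
    by (subst nn_integral_density) (auto simp: ennreal_mult' mult.commute)
  ultimately show ?thesis
    using that[of "\<lambda>x. enn2real (p0 x)"] by auto
qed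

text \<open>The converse of Bessel's inequality. Riesz--Fischer gives \<open>g\<close> with the
  Hermite moments of \<open>Y\<close>; the difference \<open>w\<close> of the density and
  \<open>g\<close> times the normal density then has only zero Hermite moments, and exponential
  integrability forces its Fourier transform, hence \<open>w\<close> itself, to vanish.\<close>

lemma chi2_le_He_moments:
  assumes "prob_space M" "distributed M lborel Y p"
    and e: "\<And>t. integrable M (\<lambda>\<omega>. exp (t * \<bar>Y \<omega>\<bar>))"
    and a: "summable (\<lambda>m. (\<integral>\<omega>. poly (He m) (Y \<omega>) \<partial>M)\<^sup>2 / fact m)"
  shows "chi2 M Y \<le> ennreal (\<Sum>m. (\<integral>\<omega>. poly (He (Suc m)) (Y \<omega>) \<partial>M)\<^sup>2 / fact (Suc m))"
proof -
  interpret prob_space M by fact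
  obtain q where [measurable]: "q \<in> borel_measurable borel" and q0: "\<forall>x. 0 \<le> q x"
    and q: "distributed M lborel Y (\<lambda>x. ennreal (q x))"
    and chi: "chi2 M Y = (\<integral>\<^sup>+x. ennreal ((q x / std_normal_density x - 1)\<^sup>2) \<partial>std_normal_distribution)"
    by (rule chi2_density[OF assms(1,2)])
  have [measurable]: "Y \<in> borel_measurable M" using distributed_measurable[OF q] by simp
  obtain g where [measurable]: "g \<in> borel_measurable borel"
    and g2: "integrable std_normal_distribution (\<lambda>x. (g x)\<^sup>2)"
    and gH: "\<forall>m. (LINT x|std_normal_distribution. g x * poly (He m) x) = (\<integral>\<omega>. poly (He m) (Y \<omega>) \<partial>M)"
    and gle: "(\<integral>\<^sup>+x. ennreal ((g x - (\<integral>\<omega>. poly (He 0) (Y \<omega>) \<partial>M))\<^sup>2) \<partial>std_normal_distribution)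
      \<le> ennreal (\<Sum>m. (\<integral>\<omega>. poly (He (Suc m)) (Y \<omega>) \<partial>M)\<^sup>2 / fact (Suc m))"
    by (rule He_Riesz_Fischer[OF a])
  have qi: "integrable lborel (\<lambda>x. q x * exp (t * \<bar>x\<bar>))" for t
    using distributed_integrable[OF q, of "\<lambda>x. exp (t * \<bar>x\<bar>)"] e[of t] q0 by simp
  have gi: "integrable lborel (\<lambda>x. std_normal_density x * (g x * exp (t * \<bar>x\<bar>)))" for t
  proof -
    have "integrable std_normal_distribution (\<lambda>x. g x * exp (t * \<bar>x\<bar>))"
    proof (rule integrable_mult_square_integrable)
      show "integrable std_normal_distribution (\<lambda>x. (exp (t * \<bar>x\<bar>))\<^sup>2)"
        using integrable_std_normal_exp[of "2 * t"] by (simp add: power2_eq_square mult_ac flip: exp_add)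
    qed (auto simp: g2)
    then show ?thesis by (subst (asm) integrable_density) auto
  qed
  define w where "w = (\<lambda>x. q x - std_normal_density x * g x)"
  have [measurable]: "w \<in> borel_measurable borel" unfolding w_def by measurable
  have wi: "integrable lborel (\<lambda>x. w x * exp (t * \<bar>x\<bar>))" for t
    using Bochner_Integration.integrable_diff[OF qi[of t] gi[of t]] by (simp add: w_def algebra_simps)
  have wH: "(\<integral>x. w x * poly (He m) x \<partial>lborel) = 0" for m
  proof -
    have "integrable lborel (\<lambda>x. q x * poly (He m) x)"
      using qi[of 1] by (intro integrable_poly_of_exp) auto
    moreover have "integrable lborel (\<lambda>x. (std_normal_density x * g x) * poly (He m) x)"
      using gi[of 1] by (intro integrable_poly_of_exp) (auto simp: mult_ac)
    moreover have "(\<integral>x. q x * poly (He m) x \<partial>lborel) = (\<integral>\<omega>. poly (He m) (Y \<omega>) \<partial>M)"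
      using distributed_integral[OF q, of "poly (He m)"] q0 by simp
    moreover have "(\<integral>x. (std_normal_density x * g x) * poly (He m) x \<partial>lborel) = (\<integral>\<omega>. poly (He m) (Y \<omega>) \<partial>M)"
      unfolding gH[rule_format, symmetric] by (subst integral_density) (auto simp: mult_ac)
    ultimately show ?thesis by (simp add: w_def left_diff_distrib)
  qed
  have "(CLINT x|lborel. of_real (w x) * iexp (t * x)) = 0" for t
  proof -
    have "(\<lambda>m. 0) sums (of_real (exp (t\<^sup>2 / 2)) * (CLINT x|lborel. of_real (w x) * iexp (t * x)))"
      using Fourier_transform_He_moments[of lborel w t] wi by (simp add: wH)
    then show ?thesis by (simp add: sums_iff)
  qed
  then have "AE x in lborel. w x = 0"
    using wi[of 0] by (intro Fourier_transform_injective) simp_all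
  then have ae: "AE x in std_normal_distribution. q x / std_normal_density x = g x"
    by (subst AE_density) (auto elim!: eventually_mono simp: w_def field_simps)
  have "chi2 M Y = (\<integral>\<^sup>+x. ennreal ((g x - 1)\<^sup>2) \<partial>std_normal_distribution)"
    unfolding chi by (rule nn_integral_cong_AE) (use ae in eventually_elim, simp)
  \<comment> \<open>Since \<open>He 0 = 1\<close> has expectation 1, the constant subtracted in
    \<open>gle\<close> is the 1 in \<open>chi2\<close>.\<close>
  then show ?thesis using gle by (simp add: prob_space)
qed

text \<open>Here \<open>u\<close> is the relative density minus 1. The last clause transfers
  functions that are square integrable under the normal law to \<open>Y\<close>, and identifies
  moments of \<open>Y\<close> with inner products against \<open>1 + u\<close>.\<close>

lemma chi2_finite_square_integrable:
  assumes "prob_space M" "chi2 M Y < \<infinity>"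
  obtains u where "u \<in> borel_measurable borel" "integrable std_normal_distribution (\<lambda>x. (u x)\<^sup>2)"
    "chi2 M Y = ennreal (LINT x|std_normal_distribution. (u x)\<^sup>2)"
    "\<forall>h\<in>borel_measurable borel. integrable std_normal_distribution (\<lambda>x. (h x)\<^sup>2) \<longrightarrow>
       integrable M (\<lambda>\<omega>. h (Y \<omega>)) \<and>
       (\<integral>\<omega>. h (Y \<omega>) \<partial>M) = (LINT x|std_normal_distribution. h x) + (LINT x|std_normal_distribution. u x * h x)"
proof -
  interpret prob_space M by fact
  have "\<exists>p. distributed M lborel Y p"
    using assms(2) by (auto simp: chi2_def split: if_splits)
  then obtain p where "distributed M lborel Y p" by blast
  then obtain q where [measurable]: "q \<in> borel_measurable borel" and q0: "\<forall>x. 0 \<le> q x"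
    and q: "distributed M lborel Y (\<lambda>x. ennreal (q x))"
    and chi: "chi2 M Y = (\<integral>\<^sup>+x. ennreal ((q x / std_normal_density x - 1)\<^sup>2) \<partial>std_normal_distribution)"
    by (rule chi2_density[OF assms(1)])
  define u where "u = (\<lambda>x. q x / std_normal_density x - 1)"
  have [measurable]: "u \<in> borel_measurable borel" unfolding u_def by measurable
  have u2: "integrable std_normal_distribution (\<lambda>x. (u x)\<^sup>2)"
    using assms(2) by (intro integrableI_nonneg) (auto simp: chi u_def)
  have "chi2 M Y = ennreal (LINT x|std_normal_distribution. (u x)\<^sup>2)"
    using nn_integral_eq_integral[OF u2] by (simp add: chi u_def)
  moreover have "integrable M (\<lambda>\<omega>. h (Y \<omega>)) \<and>
       (\<integral>\<omega>. h (Y \<omega>) \<partial>M) = (LINT x|std_normal_distribution. h x) + (LINT x|std_normal_distribution. u x * h x)"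
    if [measurable]: "h \<in> borel_measurable borel" and h2: "integrable std_normal_distribution (\<lambda>x. (h x)\<^sup>2)" for h
  proof -
    have h1: "integrable std_normal_distribution h"
      using integrable_mult_square_integrable[of "\<lambda>_. 1" std_normal_distribution h] h2 by simp
    have uh: "integrable std_normal_distribution (\<lambda>x. u x * h x)"
      by (rule integrable_mult_square_integrable) (auto simp: u2 h2)
    have eq: "q x * h x = std_normal_density x * (h x + u x * h x)" for x
      using normal_density_pos[of 1 0 x] by (simp add: u_def field_simps)
    have "integrable lborel (\<lambda>x. std_normal_density x * (h x + u x * h x))"
      using integrable_density[of "\<lambda>x. h x + u x * h x" lborel std_normal_density]
        Bochner_Integration.integrable_add[OF h1 uh] by simp
    then have "integrable M (\<lambda>\<omega>. h (Y \<omega>))"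
      using distributed_integrable[OF q, of h] q0 by (simp add: eq)
    moreover have "(\<integral>\<omega>. h (Y \<omega>) \<partial>M) = (\<integral>x. std_normal_density x * (h x + u x * h x) \<partial>lborel)"
      using distributed_integral[OF q, of h] q0 by (simp add: eq)
    moreover have "\<dots> = (LINT x|std_normal_distribution. h x + u x * h x)"
      by (subst integral_density) auto
    ultimately show ?thesis using h1 uh by simp
  qed
  ultimately show ?thesis using that[of u] u2 by auto
qed

lemma chi2_finite_exp_integrable:
  assumes "prob_space M" "chi2 M Y < \<infinity>"
  shows "integrable M (\<lambda>\<omega>. exp (t * \<bar>Y \<omega>\<bar>))"
proof -
  have e2: "integrable std_normal_distribution (\<lambda>x. (exp (t * \<bar>x\<bar>))\<^sup>2)"
    using integrable_std_normal_exp[of "2 * t"] by (simp add: power2_eq_square mult_ac flip: exp_add)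
  show ?thesis
  proof (rule chi2_finite_square_integrable[OF assms])
    fix u :: "real \<Rightarrow> real"
    assume "\<forall>h\<in>borel_measurable borel. integrable std_normal_distribution (\<lambda>x. (h x)\<^sup>2) \<longrightarrow>
       integrable M (\<lambda>\<omega>. h (Y \<omega>)) \<and>
       (\<integral>\<omega>. h (Y \<omega>) \<partial>M) = (LINT x|std_normal_distribution. h x) + (LINT x|std_normal_distribution. u x * h x)"
    from bspec[OF this, of "\<lambda>x. exp (t * \<bar>x\<bar>)"] e2 show ?thesis by simp
  qed
qed

text \<open>For \<open>m\<close> different from 0 the normal mean of \<open>He m\<close> vanishes,
  so the moment of \<open>Y\<close> is exactly the coefficient of \<open>u\<close>; without 0 in
  \<open>A\<close>, Bessel's inequality for \<open>u\<close> is the claim.\<close>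

lemma chi2_Bessel:
  assumes "prob_space M" "finite A" "0 \<notin> A"
  shows "ennreal (\<Sum>m\<in>A. (\<integral>\<omega>. poly (He m) (Y \<omega>) \<partial>M)\<^sup>2 / fact m) \<le> chi2 M Y"
proof (cases "chi2 M Y < \<infinity>")
  case True
  obtain u where u [measurable]: "u \<in> borel_measurable borel" and u2: "integrable std_normal_distribution (\<lambda>x. (u x)\<^sup>2)"
    and chi: "chi2 M Y = ennreal (LINT x|std_normal_distribution. (u x)\<^sup>2)"
    and h: "\<forall>h\<in>borel_measurable borel. integrable std_normal_distribution (\<lambda>x. (h x)\<^sup>2) \<longrightarrow>
       integrable M (\<lambda>\<omega>. h (Y \<omega>)) \<and>
       (\<integral>\<omega>. h (Y \<omega>) \<partial>M) = (LINT x|std_normal_distribution. h x) + (LINT x|std_normal_distribution. u x * h x)"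
    by (rule chi2_finite_square_integrable[OF assms(1) True])
  have "(\<integral>\<omega>. poly (He m) (Y \<omega>) \<partial>M) = (LINT x|std_normal_distribution. u x * poly (He m) x)" if "m \<in> A" for m
  proof -
    have "m \<noteq> 0" using that assms(3) by metis
    then show ?thesis
      using bspec[OF h, of "poly (He m)"] He_orthogonal[of m 0] by (simp add: integrable_std_normal_poly_square)
  qed
  then show ?thesis
    unfolding chi using He_Bessel[OF assms(2) u u2] by (intro ennreal_leI) simp
next
  case False
  then show ?thesis by (simp add: less_top[symmetric])
qed

section \<open>Recognising the normal law by its Hermite moments\<close>

text \<open>Only even powers occur, so all terms are nonnegative and can be integrated one by one
  before any exponential moment is known to be finite. The value depends on the power moments
  alone.\<close>

lemma nn_integral_cosh:
  fixes Y :: "'a \<Rightarrow> real"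
  assumes Y [measurable]: "Y \<in> borel_measurable N"
    and int: "\<And>k. integrable N (\<lambda>x. Y x ^ k)"
  shows "(\<integral>\<^sup>+x. ennreal (cosh (t * Y x)) \<partial>N) =
    (\<Sum>k. if even k then ennreal (t ^ k / fact k * (\<integral>x. Y x ^ k \<partial>N)) else 0)"
proof -
  have "ennreal (cosh (t * y)) = (\<Sum>k. ennreal (if even k then t ^ k / fact k * y ^ k else 0))" for y
  proof -
    have "(\<lambda>k. if even k then t ^ k / fact k * y ^ k else 0) sums cosh (t * y)"
      using cosh_converges[of "t * y"] by (simp add: power_mult_distrib field_simps cong: if_cong)
    then show ?thesis
      by (intro suminf_ennreal_eq[symmetric]) (auto simp: power_mult_distrib[symmetric] zero_le_even_power)
  qed
  then have "(\<integral>\<^sup>+x. ennreal (cosh (t * Y x)) \<partial>N) =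
      (\<integral>\<^sup>+x. (\<Sum>k. ennreal (if even k then t ^ k / fact k * Y x ^ k else 0)) \<partial>N)"
    by simp
  also have "\<dots> = (\<Sum>k. \<integral>\<^sup>+x. ennreal (if even k then t ^ k / fact k * Y x ^ k else 0) \<partial>N)"
    by (rule nn_integral_suminf) measurable
  also have "\<dots> = (\<Sum>k. if even k then ennreal (t ^ k / fact k * (\<integral>x. Y x ^ k \<partial>N)) else 0)"
  proof (intro suminf_cong)
    fix k
    show "(\<integral>\<^sup>+x. ennreal (if even k then t ^ k / fact k * Y x ^ k else 0) \<partial>N) =
        (if even k then ennreal (t ^ k / fact k * (\<integral>x. Y x ^ k \<partial>N)) else 0)"
    proof (cases "even k")
      case True
      then have "(\<integral>\<^sup>+x. ennreal (t ^ k / fact k * Y x ^ k) \<partial>N) = ennreal (\<integral>x. t ^ k / fact k * Y x ^ k \<partial>N)"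
        using int[of k]
        by (intro nn_integral_eq_integral) (auto intro!: mult_nonneg_nonneg simp: zero_le_even_power)
      then show ?thesis using True by simp
    qed simp
  qed
  finally show ?thesis .
qed

text \<open>Exponential moments have to be derived here: the Hermite moments fix the power moments,
  these fix the integral of \<open>cosh (t X)\<close>, and its normal value is finite. Then the
  characteristic function can be computed.\<close>

lemma chi2_eq_0_of_He_moments:
  assumes "prob_space M" and X [measurable]: "X \<in> borel_measurable M"
    and z: "\<And>m. m \<ge> 1 \<Longrightarrow> integrable M (\<lambda>\<omega>. poly (He m) (X \<omega>)) \<and> (\<integral>\<omega>. poly (He m) (X \<omega>) \<partial>M) = 0"
  shows "chi2 M X = 0"
proof -
  interpret prob_space M by fact
  have z': "integrable M (\<lambda>\<omega>. poly (He m) (X \<omega>))"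
    "(\<integral>\<omega>. poly (He m) (X \<omega>) \<partial>M) = (if m = 0 then 1 else 0)" for m
    using z[of m] by (cases m; simp add: prob_space)+
  \<comment> \<open>Multiplication by \<open>x\<close> acts on Hermite polynomials through the
    three-term recurrence, so the induction on \<open>k\<close> must carry all \<open>m\<close> at
    once.\<close>
  have mom': "integrable M (\<lambda>\<omega>. X \<omega> ^ k * poly (He m) (X \<omega>)) \<and>
    (\<integral>\<omega>. X \<omega> ^ k * poly (He m) (X \<omega>) \<partial>M) = (LINT x|std_normal_distribution. x ^ k * poly (He m) x)" for k m
  proof (induction k arbitrary: m)
    case 0
    show ?case using z'[of m] He_orthogonal[of m 0] by simp
  next
    case (Suc k)
    have eq: "x ^ Suc k * poly (He m) x = x ^ k * poly (He (Suc m)) x + real m * (x ^ k * poly (He (m - 1)) x)" for x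
      by (simp add: poly_He_Suc algebra_simps)
    have "integrable std_normal_distribution (\<lambda>x. x ^ k * poly (He l) x)" for l
      using integrable_std_normal_poly_mult[of "monom 1 k" "He l"] by (simp add: poly_monom)
    then show ?case unfolding eq using Suc by simp
  qed
  have mom: "integrable M (\<lambda>\<omega>. X \<omega> ^ k)"
    "(\<integral>\<omega>. X \<omega> ^ k \<partial>M) = (LINT x|std_normal_distribution. x ^ k)" for k
    using mom'[of k 0] by simp_all
  have cosh: "(\<integral>\<^sup>+\<omega>. ennreal (cosh (t * X \<omega>)) \<partial>M) < \<infinity>" for t
  proof -
    have "(\<integral>\<^sup>+\<omega>. ennreal (cosh (t * X \<omega>)) \<partial>M) = (\<integral>\<^sup>+x. ennreal (cosh (t * x)) \<partial>std_normal_distribution)"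
      by (subst (1 2) nn_integral_cosh) (auto simp: mom integrable_std_normal_distribution_moment cong: if_cong)
    also have "\<dots> \<le> (\<integral>\<^sup>+x. ennreal (exp (\<bar>t\<bar> * \<bar>x\<bar>)) \<partial>std_normal_distribution)"
    proof (intro nn_integral_mono ennreal_leI)
      fix x
      have "t * x \<le> \<bar>t\<bar> * \<bar>x\<bar>" "- (t * x) \<le> \<bar>t\<bar> * \<bar>x\<bar>"
        unfolding abs_mult[symmetric] by auto
      then have "exp (t * x) + exp (- (t * x)) \<le> exp (\<bar>t\<bar> * \<bar>x\<bar>) + exp (\<bar>t\<bar> * \<bar>x\<bar>)"
        by (intro add_mono) simp_all
      then show "cosh (t * x) \<le> exp (\<bar>t\<bar> * \<bar>x\<bar>)" by (simp add: cosh_field_def)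
    qed
    also have "\<dots> < \<infinity>"
      using integrable_std_normal_exp[of "\<bar>t\<bar>"] by (subst nn_integral_eq_integral) auto
    finally show ?thesis .
  qed
  have [measurable]: "(\<lambda>\<omega>. cosh (t * X \<omega>)) \<in> borel_measurable M" for t
    unfolding cosh_field_def by measurable
  have e: "integrable M (\<lambda>\<omega>. exp (t * \<bar>X \<omega>\<bar>))" for t
  proof (rule Bochner_Integration.integrable_bound)
    show "integrable M (\<lambda>\<omega>. 2 * cosh (t * X \<omega>))"
      using cosh[of t] by (intro integrable_mult_right integrableI_nonneg) (auto simp: cosh_real_nonneg)
    have "exp (t * \<bar>x\<bar>) \<le> 2 * cosh (t * x)" for x
      by (cases "x \<ge> 0") (auto simp: cosh_field_def)
    then show "AE \<omega> in M. norm (exp (t * \<bar>X \<omega>\<bar>)) \<le> norm (2 * cosh (t * X \<omega>))"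
      by (simp add: cosh_real_nonneg)
  qed measurable
  have "distr M borel X = std_normal_distribution"
  proof (rule Levy_uniqueness)
    show "real_distribution (distr M borel X)"
      by (simp add: real_distribution_def real_distribution_axioms_def prob_space_distr)
    show "real_distribution std_normal_distribution" by (rule real_dist_normal_dist)
    show "char (distr M borel X) = char std_normal_distribution"
    proof
      fix t
      \<comment> \<open>Only the term \<open>m = 0\<close> of this series survives, so the
        characteristic function is \<open>exp (- t^2 / 2)\<close>.\<close>
      have "(\<lambda>m. (\<i> * of_real t) ^ m / fact m * of_real (\<integral>x. 1 * poly (He m) x \<partial>distr M borel X)) sums
        (of_real (exp (t\<^sup>2 / 2)) * (CLINT x|distr M borel X. of_real 1 * iexp (t * x)))"
        by (rule Fourier_transform_He_moments) (auto simp: integrable_distr_eq e)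
      then have "(\<lambda>m. (\<i> * complex_of_real t) ^ m / fact m * of_real (if m = 0 then 1 else 0)) sums
        (of_real (exp (t\<^sup>2 / 2)) * char (distr M borel X) t)"
        by (simp add: integral_distr z' char_def cong: if_cong)
      moreover have "(\<lambda>m. (\<i> * complex_of_real t) ^ m / fact m * of_real (if m = 0 then 1 else 0)) =
          (\<lambda>m. if m = 0 then 1 else 0)" by auto
      ultimately have "of_real (exp (t\<^sup>2 / 2)) * char (distr M borel X) t = 1"
        using sums_single[of 0 "\<lambda>_. 1 :: complex"] by (auto dest: sums_unique2)
      then have "char (distr M borel X) t = of_real (inverse (exp (t\<^sup>2 / 2)))"
        by (simp add: field_simps)
      then show "char (distr M borel X) t = char std_normal_distribution t"
        by (simp add: char_std_normal_distribution exp_minus)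
    qed
  qed
  then have "distributed M lborel X std_normal_density"
    by (simp add: distributed_def) (metis distr_cong sets_lborel)
  from chi2_le_He_moments[OF assms(1) this e]
  have "chi2 M X \<le> ennreal (\<Sum>m. (\<integral>\<omega>. poly (He (Suc m)) (X \<omega>) \<partial>M)\<^sup>2 / fact (Suc m))"
    by (simp add: z' if_distrib[of "\<lambda>x. x / _"] if_distrib[of "\<lambda>x. x\<^sup>2"] cong: if_cong)
  then show ?thesis by (simp add: z')
qed

subsection \<open>Sums of independent random variables\<close>

text \<open>Densities of independent summands convolve. The induction starts at singletons, since
  the empty sum has no density.\<close>

lemma (in prob_space) distributed_sum_indep:
  assumes "finite I" "I \<noteq> {}" "indep_vars (\<lambda>_. borel) X I"
    and "\<And>i. i \<in> I \<Longrightarrow> \<exists>p. distributed M lborel (X i) p"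
  shows "\<exists>p. distributed M lborel (\<lambda>\<omega>. \<Sum>i\<in>I. X i \<omega> :: real) p"
  using assms
proof (induction I rule: finite_ne_induct)
  case (insert i I)
  have "\<exists>p. distributed M lborel (\<lambda>\<omega>. \<Sum>i\<in>I. X i \<omega>) p"
    using insert.prems indep_vars_subset[OF insert.prems(1), of I] by (intro insert.IH) auto
  then obtain p where p: "distributed M lborel (\<lambda>\<omega>. \<Sum>i\<in>I. X i \<omega>) p" by blast
  obtain q where q: "distributed M lborel (X i) q" using insert.prems(2)[of i] by auto
  have "indep_var borel (X i) borel (\<lambda>\<omega>. \<Sum>i\<in>I. X i \<omega>)"
    using insert.hyps insert.prems(1) by (intro indep_vars_sum) auto
  from distributed_convolution[OF this q p] insert.hyps show ?case by auto
qed auto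

text \<open>The triangle inequality gives a product of independent exponentials as a dominating
  function.\<close>

lemma (in prob_space) exp_integrable_sum_indep:
  fixes X :: "'i \<Rightarrow> 'a \<Rightarrow> real"
  assumes "finite I" and indep: "indep_vars (\<lambda>_. borel) X I"
    and e: "\<And>i t. i \<in> I \<Longrightarrow> integrable M (\<lambda>\<omega>. exp (t * \<bar>X i \<omega>\<bar>))"
  shows "integrable M (\<lambda>\<omega>. exp (t * \<bar>(\<Sum>i\<in>I. X i \<omega>) / c\<bar>))"
proof (rule Bochner_Integration.integrable_bound)
  have [measurable]: "X i \<in> borel_measurable M" if "i \<in> I" for i
    using indep that by (auto simp: indep_vars_def)
  let ?s = "\<bar>t\<bar> / \<bar>c\<bar>"
  show "integrable M (\<lambda>\<omega>. \<Prod>i\<in>I. exp (?s * \<bar>X i \<omega>\<bar>))"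
  proof (rule indep_vars_integrable[OF assms(1)])
    show "indep_vars (\<lambda>_. borel) (\<lambda>i \<omega>. exp (?s * \<bar>X i \<omega>\<bar>)) I"
      by (rule indep_vars_compose2[OF indep]) measurable
  qed (rule e)
  show "(\<lambda>\<omega>. exp (t * \<bar>(\<Sum>i\<in>I. X i \<omega>) / c\<bar>)) \<in> borel_measurable M"
    by measurable
  have "exp (t * \<bar>(\<Sum>i\<in>I. X i \<omega>) / c\<bar>) \<le> (\<Prod>i\<in>I. exp (?s * \<bar>X i \<omega>\<bar>))" for \<omega>
  proof -
    have "t * \<bar>(\<Sum>i\<in>I. X i \<omega>) / c\<bar> \<le> \<bar>t\<bar> * \<bar>(\<Sum>i\<in>I. X i \<omega>) / c\<bar>"
      by (intro mult_right_mono) auto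
    also have "\<dots> = ?s * \<bar>\<Sum>i\<in>I. X i \<omega>\<bar>" by simp
    also have "\<dots> \<le> ?s * (\<Sum>i\<in>I. \<bar>X i \<omega>\<bar>)"
      by (intro mult_left_mono sum_abs) auto
    finally show ?thesis by (simp add: exp_sum[OF assms(1), symmetric] sum_distrib_left)
  qed
  then show "AE \<omega> in M. norm (exp (t * \<bar>(\<Sum>i\<in>I. X i \<omega>) / c\<bar>)) \<le> norm (\<Prod>i\<in>I. exp (?s * \<bar>X i \<omega>\<bar>))"
    by (simp add: prod_nonneg)
qed

lemma (in prob_space) integrable_poly_of_exp_moment:
  fixes Y :: "'a \<Rightarrow> real"
  assumes [measurable]: "Y \<in> borel_measurable M" and e: "\<And>t. integrable M (\<lambda>\<omega>. exp (t * \<bar>Y \<omega>\<bar>))"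
  shows "integrable M (\<lambda>\<omega>. poly p (Y \<omega>))"
  using integrable_poly_of_exp[of "\<lambda>_. 1" M Y p] e[of 1] by simp

text \<open>Take expectations in \<open>hermite_fps_number_operator\<close>. As \<open>R k\<close>
  involves only variables other than \<open>X k\<close>, the expectation of each product
  factors.\<close>

lemma (in prob_space) He_moments_sum_indep:
  fixes n :: nat and X :: "nat \<Rightarrow> 'a \<Rightarrow> real"
  defines "S \<equiv> \<lambda>\<omega>. (\<Sum>k=1..n. X k \<omega>) / sqrt (real n)"
    and "R \<equiv> \<lambda>k \<omega>. (\<Sum>i\<in>{1..n} - {k}. X i \<omega>) / sqrt (real n - 1)"
  assumes n: "n \<ge> 2" and indep: "indep_vars (\<lambda>_. borel) X {1..n}"
    and e: "\<And>i t. i \<in> {1..n} \<Longrightarrow> integrable M (\<lambda>\<omega>. exp (t * \<bar>X i \<omega>\<bar>))"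
  shows "real m * expectation (\<lambda>\<omega>. poly (He m) (S \<omega>)) / fact m =
    (\<Sum>k=1..n. \<Sum>j\<le>m. real j * (expectation (\<lambda>\<omega>. poly (He j) (X k \<omega>)) * (1 / sqrt n) ^ j / fact j) *
       (expectation (\<lambda>\<omega>. poly (He (m - j)) (R k \<omega>)) * sqrt (1 - 1 / n) ^ (m - j) / fact (m - j)))"
proof -
  have X [measurable]: "X i \<in> borel_measurable M" if "i \<in> {1..n}" for i
    using indep that by (auto simp: indep_vars_def)
  have R [measurable]: "R k \<in> borel_measurable M" for k
    unfolding R_def by (intro borel_measurable_divide borel_measurable_sum X) auto
  have prod: "integrable M (\<lambda>\<omega>. poly p (X k \<omega>) * poly q (R k \<omega>)) \<and>
      expectation (\<lambda>\<omega>. poly p (X k \<omega>) * poly q (R k \<omega>)) =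
      expectation (\<lambda>\<omega>. poly p (X k \<omega>)) * expectation (\<lambda>\<omega>. poly q (R k \<omega>))"
    if k: "k \<in> {1..n}" for k p q
  proof -
    have "indep_vars (\<lambda>_. borel) X (insert k ({1..n} - {k}))"
      using indep k by (simp add: insert_absorb)
    then have "indep_var borel (X k) borel (\<lambda>\<omega>. \<Sum>i\<in>{1..n} - {k}. X i \<omega>)"
      by (intro indep_vars_sum) auto
    then have "indep_var borel (poly p \<circ> X k) borel ((\<lambda>x. poly q (x / sqrt (real n - 1))) \<circ> (\<lambda>\<omega>. \<Sum>i\<in>{1..n} - {k}. X i \<omega>))"
      by (rule indep_var_compose) measurable
    then have ind: "indep_var borel (\<lambda>\<omega>. poly p (X k \<omega>)) borel (\<lambda>\<omega>. poly q (R k \<omega>))"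
      by (simp add: o_def R_def)
    have 1: "integrable M (\<lambda>\<omega>. poly p (X k \<omega>))"
      using k by (intro integrable_poly_of_exp_moment e) auto
    have 2: "integrable M (\<lambda>\<omega>. poly q (R k \<omega>))"
      unfolding R_def
      by (intro integrable_poly_of_exp_moment exp_integrable_sum_indep indep_vars_subset[OF indep] e
          borel_measurable_divide borel_measurable_sum X) auto
    show ?thesis
      using indep_var_lebesgue_integral[OF ind 1 2] indep_var_integrable[OF ind 1 2] by simp
  qed
  have "real m * expectation (\<lambda>\<omega>. poly (He m) (S \<omega>)) / fact m = expectation (\<lambda>\<omega>. real m * poly (He m) (S \<omega>) / fact m)"
    by simp
  also have "\<dots> = expectation (\<lambda>\<omega>. \<Sum>k=1..n. \<Sum>j\<le>m. (real j * (1 / sqrt n) ^ j / fact j * sqrt (1 - 1 / n) ^ (m - j) / fact (m - j)) *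
       (poly (He j) (X k \<omega>) * poly (He (m - j)) (R k \<omega>)))"
    unfolding S_def R_def
    by (subst hermite_fps_number_operator[OF n]) (simp add: mult_ac)
  also have "\<dots> = (\<Sum>k=1..n. \<Sum>j\<le>m. (real j * (1 / sqrt n) ^ j / fact j * sqrt (1 - 1 / n) ^ (m - j) / fact (m - j)) *
       (expectation (\<lambda>\<omega>. poly (He j) (X k \<omega>)) * expectation (\<lambda>\<omega>. poly (He (m - j)) (R k \<omega>))))"
  proof -
    have int: "integrable M (\<lambda>\<omega>. c * (poly p (X k \<omega>) * poly q (R k \<omega>)))" if "k \<in> {1..n}" for k c p q
      using prod[OF that, of p q] by simp
    have int': "integrable M (\<lambda>\<omega>. \<Sum>j\<le>m. c j * (poly (p j) (X k \<omega>) * poly (q j) (R k \<omega>)))"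
      if "k \<in> {1..n}" for k c p q
      by (intro Bochner_Integration.integrable_sum int that)
    show ?thesis
      by (subst Bochner_Integration.integral_sum, erule int', intro sum.cong refl,
          subst Bochner_Integration.integral_sum, erule int, simp add: prod)
  qed
  finally show ?thesis by (simp add: mult_ac)
qed

subsection \<open>The moment inequality\<close>

text \<open>The left side is a partial sum of negative binomial probabilities. By Pascal's rule a
  factor \<open>1 - p\<close> lowers \<open>s\<close> by one and leaves a nonpositive boundary
  term.\<close>

lemma negative_binomial_partial_sum_le:
  fixes p :: real
  assumes "0 \<le> p" "p \<le> 1"
  shows "(1 - p) ^ Suc s * (\<Sum>k\<le>K. real ((k + s) choose k) * p ^ k) \<le> 1"
proof (induction s)
  case 0
  show ?case using assms by (simp add: sum_gp_basic)
next
  case (Suc s)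
  have "(1 - p) * (\<Sum>k\<le>K. real ((k + Suc s) choose k) * p ^ k) =
      (\<Sum>k\<le>K. real ((k + s) choose k) * p ^ k) - real ((K + Suc s) choose K) * p ^ Suc K"
  proof (induction K)
    case (Suc K)
    have "(Suc K + Suc s) choose Suc K = ((K + Suc s) choose K) + ((Suc K + s) choose Suc K)"
      using binomial_Suc_Suc[of "K + Suc s" K] by simp
    then show ?case
      unfolding sum.atMost_Suc distrib_left Suc.IH by (simp add: algebra_simps)
  qed simp
  also have "\<dots> \<le> (\<Sum>k\<le>K. real ((k + s) choose k) * p ^ k)"
    using assms by simp
  finally have "(1 - p) ^ Suc s * ((1 - p) * (\<Sum>k\<le>K. real ((k + Suc s) choose k) * p ^ k)) \<le>
      (1 - p) ^ Suc s * (\<Sum>k\<le>K. real ((k + s) choose k) * p ^ k)"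
    using assms by (intro mult_left_mono) auto
  then show ?case using Suc by (simp add: mult_ac)
qed

text \<open>For \<open>s = 0\<close> and \<open>k >= 1\<close> this is \<open>p ^ k\<close>, so the
  same weight also produces the geometric sum of the first coefficient.\<close>

definition hJ_term :: "real \<Rightarrow> nat \<Rightarrow> nat \<Rightarrow> real" where
  "hJ_term p s k = real k ^ 2 / real (k + s) ^ 2 * real ((k + s) choose k) * p ^ k"

lemma hJ_term_nonneg: "0 \<le> p \<Longrightarrow> 0 \<le> hJ_term p s k"
  by (simp add: hJ_term_def)

text \<open>The factor \<open>k^2 / (k + s)^2\<close> is at most 1; what remains is a negative
  binomial sum.\<close>

lemma hJ_term_sum_le:
  assumes "0 \<le> p" "p < 1" "finite F"
  shows "(\<Sum>k\<in>F. hJ_term p s k) \<le> 1 / (1 - p) ^ Suc s"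
proof -
  obtain K where K: "F \<subseteq> {..K}" using \<open>finite F\<close> finite_nat_iff_bounded_le by auto
  have "(\<Sum>k\<in>F. hJ_term p s k) \<le> (\<Sum>k\<le>K. hJ_term p s k)"
    using assms K by (intro sum_mono2) (auto simp: hJ_term_nonneg)
  also have "\<dots> \<le> (\<Sum>k\<le>K. real ((k + s) choose k) * p ^ k)"
  proof (rule sum_mono)
    fix k
    have "real k ^ 2 / real (k + s) ^ 2 \<le> 1"
      by (cases "k + s = 0") (auto simp: divide_le_eq power_mono)
    then have "real k ^ 2 / real (k + s) ^ 2 * (real ((k + s) choose k) * p ^ k) \<le> 1 * (real ((k + s) choose k) * p ^ k)"
      using assms by (intro mult_right_mono) auto
    then show "hJ_term p s k \<le> real ((k + s) choose k) * p ^ k"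
      by (simp add: hJ_term_def mult.assoc)
  qed
  also have "\<dots> \<le> 1 / (1 - p) ^ Suc s"
    using negative_binomial_partial_sum_le[of p s K] assms by (simp add: field_simps)
  finally show ?thesis .
qed

lemma hJ_term_summable_on:
  assumes "0 \<le> p" "p < 1"
  shows "hJ_term p s summable_on A"
  by (rule nonneg_bdd_above_summable_on)
    (use assms hJ_term_sum_le[of p _ s] in \<open>auto simp: hJ_term_nonneg intro!: bdd_aboveI\<close>)

lemma hJ_eq: "hJ J s p = (1 - p) ^ s / p\<^sup>2 * infsum (hJ_term p s) {k. 1 \<le> k \<and> k \<notin> J}"
  unfolding hJ_def hJ_term_def ..

text \<open>A real supremum is an upper bound only for a bounded family. The power of
  \<open>1 - p\<close> in \<open>hJ\<close> cancels all but one factor of the bound on the sum,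
  leaving a bound independent of \<open>s\<close>.\<close>

lemma hJ_le_CJ:
  assumes "0 < p" "p < 1" "1 \<le> s"
  shows "hJ J s p \<le> CJ J p"
  unfolding CJ_def
proof (rule cSUP_upper)
  show "bdd_above ((\<lambda>s. hJ J s p) ` {1..})"
  proof (rule bdd_aboveI2)
    fix s
    have "infsum (hJ_term p s) {k. 1 \<le> k \<and> k \<notin> J} \<le> 1 / (1 - p) ^ Suc s"
      using assms by (intro infsum_le_finite_sums hJ_term_summable_on hJ_term_sum_le) auto
    then have "hJ J s p \<le> (1 - p) ^ s / p\<^sup>2 * (1 / (1 - p) ^ Suc s)"
      unfolding hJ_eq using assms by (intro mult_left_mono) auto
    also have "\<dots> = 1 / (p\<^sup>2 * (1 - p))"
      using assms by simp
    finally show "hJ J s p \<le> 1 / (p\<^sup>2 * (1 - p))" .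
  qed
qed (use assms in auto)

lemma hJ_nonneg: "0 < p \<Longrightarrow> p < 1 \<Longrightarrow> 0 \<le> hJ J s p"
  unfolding hJ_eq by (intro mult_nonneg_nonneg infsum_nonneg) (auto simp: hJ_term_nonneg)

lemma CJ_nonneg: "0 < p \<Longrightarrow> p < 1 \<Longrightarrow> 0 \<le> CJ J p"
  using hJ_nonneg[of p J 1] hJ_le_CJ[of p 1 J] by simp

lemma hJ_term_sum_le_CJ:
  assumes "0 < p" "p < 1" "1 \<le> s" "finite F" "F \<subseteq> {k. 1 \<le> k \<and> k \<notin> J}"
  shows "(\<Sum>k\<in>F. (1 - p) ^ s * hJ_term p s k) \<le> p\<^sup>2 * CJ J p"
proof -
  have "(\<Sum>k\<in>F. hJ_term p s k) \<le> infsum (hJ_term p s) {k. 1 \<le> k \<and> k \<notin> J}"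
    using assms by (intro finite_sum_le_infsum hJ_term_summable_on) (auto simp: hJ_term_nonneg)
  then have "(1 - p) ^ s * (\<Sum>k\<in>F. hJ_term p s k) \<le> (1 - p) ^ s * infsum (hJ_term p s) {k. 1 \<le> k \<and> k \<notin> J}"
    using assms by (intro mult_left_mono) auto
  also have "\<dots> = p\<^sup>2 * hJ J s p"
    using assms by (simp add: hJ_eq)
  also have "\<dots> \<le> p\<^sup>2 * CJ J p"
    using assms by (intro mult_left_mono hJ_le_CJ) auto
  finally show ?thesis by (simp add: sum_distrib_left)
qed

text \<open>The map from \<open>(m, j)\<close> to \<open>(m - j, j)\<close> embeds the triangle
  injectively into a rectangle, and the additional terms are nonnegative.\<close>

lemma sum_pairs_le:
  fixes f :: "nat \<Rightarrow> nat \<Rightarrow> real"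
  assumes "\<And>j s. 0 \<le> f j s"
  shows "(\<Sum>m=1..N. \<Sum>j\<in>{1..m} - J. f j (m - j)) \<le> (\<Sum>s\<le>N. \<Sum>j\<in>{1..N} - J. f j s)"
proof -
  let ?S = "SIGMA m:{1..N}. {1..m} - J"
  have "(\<Sum>m=1..N. \<Sum>j\<in>{1..m} - J. f j (m - j)) = (\<Sum>(m, j)\<in>?S. f j (m - j))"
    by (rule sum.Sigma) auto
  also have "\<dots> = (\<Sum>(s, j)\<in>(\<lambda>(m, j). (m - j, j)) ` ?S. f j s)"
    by (subst sum.reindex) (auto simp: inj_on_def case_prod_beta)
  also have "\<dots> \<le> (\<Sum>(s, j)\<in>{..N} \<times> ({1..N} - J). f j s)"
    using assms by (intro sum_mono2) auto
  also have "\<dots> = (\<Sum>s\<le>N. \<Sum>j\<in>{1..N} - J. f j s)"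
    by (rule sum.cartesian_product[symmetric])
  finally show ?thesis .
qed

section \<open>The two Cauchy--Schwarz steps on truncated sums\<close>

text \<open>Stated for real arrays and a finite cutoff \<open>N\<close>, which separates the algebra
  from questions of integrability and infinite values.\<close>

lemma He_moments_bound:
  fixes n :: nat and a b :: "nat \<Rightarrow> nat \<Rightarrow> real" and A :: "nat \<Rightarrow> real"
  defines "p \<equiv> 1 / real n"
  assumes n: "n \<ge> 2"
    and A: "\<And>m. real m * A m / fact m =
      (\<Sum>k=1..n. \<Sum>j\<le>m. real j * (a k j * (1 / sqrt n) ^ j / fact j) *
         (b k (m - j) * sqrt (1 - 1 / n) ^ (m - j) / fact (m - j)))"
    and aJ: "\<And>k j. k \<in> {1..n} \<Longrightarrow> j \<in> J \<Longrightarrow> a k j = 0"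
    and b0: "\<And>k. b k 0 = 1"
  shows "(\<Sum>m=1..N. (A m)\<^sup>2 / fact m) \<le>
    (\<Sum>k=1..n. (\<Sum>j=1..N. (a k j)\<^sup>2 / fact j) *
       (real n * (\<Sum>j\<in>{1..N} - J. p ^ j) + CJ J p / real n * (\<Sum>s=1..N. (b k s)\<^sup>2 / fact s)))"
proof -
  have p: "0 < p" "p < 1" using n by (auto simp: p_def)
  define U where "U = (\<lambda>k. \<Sum>j=1..N. (a k j)\<^sup>2 / fact j)"
  define \<beta> where "\<beta> = (\<lambda>k s. (b k s)\<^sup>2 / fact s)"
  define w where "w = (\<lambda>j s. (1 - p) ^ s * hJ_term p s j)"
  define T where "T = (\<lambda>k m. \<Sum>j\<le>m. real j * (a k j * (1 / sqrt n) ^ j / fact j) *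
         (b k (m - j) * sqrt (1 - 1 / n) ^ (m - j) / fact (m - j)))"
  have w_nonneg: "0 \<le> w j s" for j s using p by (simp add: w_def hJ_term_nonneg)
  have \<beta>_nonneg: "0 \<le> \<beta> k s" for k s by (simp add: \<beta>_def)
  have U_nonneg: "0 \<le> U k" for k by (simp add: U_def sum_nonneg)
  have T_bound: "fact m / (real m)\<^sup>2 * (T k m)\<^sup>2 \<le> U k * (\<Sum>j\<in>{1..m} - J. w j (m - j) * \<beta> k (m - j))"
    if k: "k \<in> {1..n}" and m: "m \<in> {1..N}" for k m
  proof -
    \<comment> \<open>One \<open>fact j\<close> is shared as two square roots, so that the squares
      of \<open>\<alpha>\<close> sum to at most \<open>U k\<close>; everything else goes into
      \<open>\<gamma>\<close>.\<close>
    define \<alpha> where "\<alpha> = (\<lambda>j. a k j / sqrt (fact j))"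
    define \<gamma> where "\<gamma> = (\<lambda>j. real j * (1 / sqrt n) ^ j * b k (m - j) * sqrt (1 - 1 / n) ^ (m - j) / (sqrt (fact j) * fact (m - j)))"
    have "T k m = (\<Sum>j\<in>{1..m} - J. \<alpha> j * \<gamma> j)"
      unfolding T_def
    proof (rule sum.mono_neutral_cong_right)
      \<comment> \<open>The term \<open>j = 0\<close> vanishes by its factor \<open>real j\<close>,
        the terms with \<open>j\<close> in \<open>J\<close> by \<open>aJ\<close>.\<close>
      show "\<forall>j\<in>{..m} - ({1..m} - J). real j * (a k j * (1 / sqrt n) ^ j / fact j) *
         (b k (m - j) * sqrt (1 - 1 / n) ^ (m - j) / fact (m - j)) = 0"
        using aJ[OF k] by (auto simp: not_less_eq_eq)
      fix j
      have "sqrt (fact j) * sqrt (fact j) = (fact j :: real)" by simp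
      then show "real j * (a k j * (1 / sqrt n) ^ j / fact j) *
         (b k (m - j) * sqrt (1 - 1 / n) ^ (m - j) / fact (m - j)) = \<alpha> j * \<gamma> j"
        unfolding \<alpha>_def \<gamma>_def times_divide_times_eq by (simp add: mult_ac flip: mult.assoc[of "sqrt (fact j)"])
    qed auto
    then have "(T k m)\<^sup>2 \<le> (\<Sum>j\<in>{1..m} - J. (\<alpha> j)\<^sup>2) * (\<Sum>j\<in>{1..m} - J. (\<gamma> j)\<^sup>2)"
      using Cauchy_Schwarz_ineq_sum by metis
    also have "\<dots> \<le> U k * (\<Sum>j\<in>{1..m} - J. (\<gamma> j)\<^sup>2)"
    proof (rule mult_right_mono)
      have "(\<Sum>j\<in>{1..m} - J. (\<alpha> j)\<^sup>2) = (\<Sum>j\<in>{1..m} - J. (a k j)\<^sup>2 / fact j)"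
        by (simp add: \<alpha>_def power_divide)
      also have "\<dots> \<le> U k"
        unfolding U_def using m by (intro sum_mono2) auto
      finally show "(\<Sum>j\<in>{1..m} - J. (\<alpha> j)\<^sup>2) \<le> U k" .
    qed (simp add: sum_nonneg)
    finally have "fact m / (real m)\<^sup>2 * (T k m)\<^sup>2 \<le> fact m / (real m)\<^sup>2 * (U k * (\<Sum>j\<in>{1..m} - J. (\<gamma> j)\<^sup>2))"
      by (intro mult_left_mono) auto
    also have "\<dots> = U k * (\<Sum>j\<in>{1..m} - J. fact m / (real m)\<^sup>2 * (\<gamma> j)\<^sup>2)"
      by (simp add: sum_distrib_left mult_ac)
    also have "(\<Sum>j\<in>{1..m} - J. fact m / (real m)\<^sup>2 * (\<gamma> j)\<^sup>2) = (\<Sum>j\<in>{1..m} - J. w j (m - j) * \<beta> k (m - j))"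
    proof (rule sum.cong[OF refl])
      fix j assume j: "j \<in> {1..m} - J"
      have 1: "(sqrt n ^ j)\<^sup>2 = real n ^ j"
        by (metis power_mult mult.commute real_sqrt_pow2 of_nat_0_le_iff)
      have 2: "(sqrt (1 - 1 / n) ^ (m - j))\<^sup>2 = (1 - p) ^ (m - j)"
        using p by (metis p_def power_mult mult.commute real_sqrt_pow2 diff_ge_0_iff_ge less_imp_le)
      have "(\<gamma> j)\<^sup>2 = (real j)\<^sup>2 * p ^ j * (b k (m - j))\<^sup>2 * (1 - p) ^ (m - j) / (fact j * (fact (m - j))\<^sup>2)"
        unfolding \<gamma>_def power_divide power_mult_distrib 1 2 by (simp add: p_def power_divide)
      \<comment> \<open>One of the two factors \<open>fact (m - j)\<close> completes the binomial
        coefficient in \<open>w\<close>; the other is the denominator in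
        \<open>\<beta>\<close>.\<close>
      moreover have "real (m choose j) = fact m / (fact j * fact (m - j))"
        using j by (intro binomial_fact) auto
      ultimately show "fact m / (real m)\<^sup>2 * (\<gamma> j)\<^sup>2 = w j (m - j) * \<beta> k (m - j)"
        using j by (simp add: w_def hJ_term_def \<beta>_def power2_eq_square[of "fact _"] mult_ac)
    qed
    finally show ?thesis .
  qed
  have A_bound: "(A m)\<^sup>2 / fact m \<le> real n * (\<Sum>k=1..n. U k * (\<Sum>j\<in>{1..m} - J. w j (m - j) * \<beta> k (m - j)))"
    if m: "m \<in> {1..N}" for m
  proof -
    have "A m = fact m / real m * (\<Sum>k=1..n. T k m)"
      using A[of m] m by (simp add: T_def field_simps)
    then have "(A m)\<^sup>2 / fact m = fact m / (real m)\<^sup>2 * (\<Sum>k=1..n. T k m)\<^sup>2"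
      by (simp add: power_mult_distrib power_divide power2_eq_square[of "fact _"])
    also have "\<dots> \<le> fact m / (real m)\<^sup>2 * (real n * (\<Sum>k=1..n. (T k m)\<^sup>2))"
      using Cauchy_Schwarz_ineq_sum[of "\<lambda>_. 1" "\<lambda>k. T k m" "{1..n}"] by (intro mult_left_mono) auto
    also have "\<dots> = real n * (\<Sum>k=1..n. fact m / (real m)\<^sup>2 * (T k m)\<^sup>2)"
      by (simp add: sum_distrib_left mult_ac)
    also have "\<dots> \<le> real n * (\<Sum>k=1..n. U k * (\<Sum>j\<in>{1..m} - J. w j (m - j) * \<beta> k (m - j)))"
      using m by (intro mult_left_mono sum_mono T_bound) auto
    finally show ?thesis .
  qed
  have row: "(\<Sum>m=1..N. \<Sum>j\<in>{1..m} - J. w j (m - j) * \<beta> k (m - j)) \<le>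
      (\<Sum>j\<in>{1..N} - J. p ^ j) + p\<^sup>2 * CJ J p * (\<Sum>s=1..N. \<beta> k s)" for k
  proof -
    have "(\<Sum>m=1..N. \<Sum>j\<in>{1..m} - J. w j (m - j) * \<beta> k (m - j)) \<le> (\<Sum>s\<le>N. \<Sum>j\<in>{1..N} - J. w j s * \<beta> k s)"
      by (rule sum_pairs_le) (simp add: w_nonneg \<beta>_nonneg)
    \<comment> \<open>The row \<open>s = 0\<close> lies outside the range of \<open>CJ\<close>;
      there \<open>w j 0 = p ^ j\<close> and the moment \<open>b k 0\<close> is 1.\<close>
    also have "{..N} = insert 0 {1..N}" by auto
    also have "(\<Sum>s\<in>insert 0 {1..N}. \<Sum>j\<in>{1..N} - J. w j s * \<beta> k s) =
        (\<Sum>j\<in>{1..N} - J. w j 0 * \<beta> k 0) + (\<Sum>s=1..N. \<Sum>j\<in>{1..N} - J. w j s * \<beta> k s)"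
      by simp
    also have "(\<Sum>j\<in>{1..N} - J. w j 0 * \<beta> k 0) = (\<Sum>j\<in>{1..N} - J. p ^ j)"
      by (intro sum.cong) (auto simp: w_def hJ_term_def \<beta>_def b0)
    also have "(\<Sum>s=1..N. \<Sum>j\<in>{1..N} - J. w j s * \<beta> k s) = (\<Sum>s=1..N. (\<Sum>j\<in>{1..N} - J. w j s) * \<beta> k s)"
      by (simp add: sum_distrib_right)
    also have "\<dots> \<le> (\<Sum>s=1..N. (p\<^sup>2 * CJ J p) * \<beta> k s)"
      unfolding w_def using p by (intro sum_mono mult_right_mono hJ_term_sum_le_CJ \<beta>_nonneg) auto
    finally show ?thesis by (simp add: sum_distrib_left)
  qed
  have "(\<Sum>m=1..N. (A m)\<^sup>2 / fact m) \<le>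
      (\<Sum>m=1..N. real n * (\<Sum>k=1..n. U k * (\<Sum>j\<in>{1..m} - J. w j (m - j) * \<beta> k (m - j))))"
    by (rule sum_mono) (rule A_bound)
  also have "\<dots> = (\<Sum>k=1..n. real n * U k * (\<Sum>m=1..N. \<Sum>j\<in>{1..m} - J. w j (m - j) * \<beta> k (m - j)))"
    unfolding sum_distrib_left by (subst sum.swap) (simp add: mult_ac)
  also have "\<dots> \<le> (\<Sum>k=1..n. real n * U k * ((\<Sum>j\<in>{1..N} - J. p ^ j) + p\<^sup>2 * CJ J p * (\<Sum>s=1..N. \<beta> k s)))"
    by (intro sum_mono mult_left_mono row mult_nonneg_nonneg U_nonneg) auto
  \<comment> \<open>Here \<open>real n * p^2\<close> collapses to \<open>1 / real n\<close>.\<close>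
  also have "\<dots> = (\<Sum>k=1..n. U k * (real n * (\<Sum>j\<in>{1..N} - J. p ^ j) + CJ J p / real n * (\<Sum>s=1..N. \<beta> k s)))"
    using n by (intro sum.cong refl) (simp add: p_def power2_eq_square field_simps)
  finally show ?thesis unfolding U_def \<beta>_def .
qed

text \<open>For a finite right-hand side every \<open>chi2 M (X k)\<close> is shown to be finite.
  This yields densities and exponential moments, for \<open>S_n\<close> as well, and the truncated
  moment bounds can pass to the limit.\<close>

theorem theorem6:
  fixes M :: "'a measure" and X :: "nat \<Rightarrow> 'a \<Rightarrow> real" and n :: nat and J :: "nat set"
  assumes "prob_space M"
    and "n \<ge> 2"
    and "\<And>j. j \<in> {1..n} \<Longrightarrow> X j \<in> borel_measurable M"
    and "prob_space.indep_vars M (\<lambda>_. borel) X {1..n}"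
    and "\<And>j. j \<in> {1..n} \<Longrightarrow> integrable M (X j) \<and> prob_space.expectation M (X j) = 0"
    and "\<And>j. j \<in> {1..n} \<Longrightarrow>
           integrable M (\<lambda>\<omega>. (X j \<omega>)\<^sup>2) \<and> prob_space.expectation M (\<lambda>\<omega>. (X j \<omega>)\<^sup>2) = 1"
    and "J \<subseteq> {1..}"
    and "\<And>k j. k \<in> J \<Longrightarrow> j \<in> {1..n} \<Longrightarrow>
           integrable M (\<lambda>\<omega>. hermite k (X j \<omega>)) \<and>
           prob_space.expectation M (\<lambda>\<omega>. hermite k (X j \<omega>)) = 0"
  shows "chi2 M (\<lambda>\<omega>. (\<Sum>j=1..n. X j \<omega>) / sqrt (real n))
    \<le> ennreal (\<Sum>\<^sub>\<infinity> j \<in> {j. 1 \<le> j \<and> j \<notin> J}. real n ^ 2 / real n ^ j)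
        * ennreal (1 / real n) * (\<Sum>k=1..n. chi2 M (X k))
      + ennreal (CJ J (1 / real n) / real n)
        * (\<Sum>k=1..n. chi2 M (X k)
             * chi2 M (\<lambda>\<omega>. (\<Sum>j\<in>{1..n} - {k}. X j \<omega>) / sqrt (real n - 1)))"
proof -
  interpret prob_space M by fact
  note n = assms(2) and X [measurable] = assms(3) and indep = assms(4)
  define S where "S = (\<lambda>\<omega>. (\<Sum>k=1..n. X k \<omega>) / sqrt (real n))"
  define R where "R = (\<lambda>k \<omega>. (\<Sum>i\<in>{1..n} - {k}. X i \<omega>) / sqrt (real n - 1))"
  \<comment> \<open>A quotient of powers, because the exponent \<open>2 - j\<close> is negative for
    large \<open>j\<close>.\<close>
  define C1 where "C1 = (\<Sum>\<^sub>\<infinity> j \<in> {j. 1 \<le> j \<and> j \<notin> J}. real n ^ 2 / real n ^ j)"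
  define C2 where "C2 = CJ J (1 / real n)"
  define RHS where "RHS = ennreal C1 * ennreal (1 / real n) * (\<Sum>k=1..n. chi2 M (X k))
    + ennreal (C2 / real n) * (\<Sum>k=1..n. chi2 M (X k) * chi2 M (R k))"
  have p: "0 < 1 / real n" "1 / real n < 1" using n by auto
  have C2: "0 \<le> C2" unfolding C2_def using p by (rule CJ_nonneg)
  have geo: "(\<lambda>j. real n ^ 2 / real n ^ j) summable_on A" for A
  proof -
    have "summable (\<lambda>j. norm (real n ^ 2 * (1 / real n) ^ j))"
      using p by (intro summable_norm_comparison_test[OF _ summable_mult[OF summable_geometric]]) auto
    then have "(\<lambda>j. real n ^ 2 * (1 / real n) ^ j) summable_on UNIV"
      by (rule norm_summable_imp_summable_on)
    then have "(\<lambda>j. real n ^ 2 * (1 / real n) ^ j) summable_on A"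
      by (rule summable_on_subset_banach) simp
    then show ?thesis by (simp add: power_divide)
  qed
  have C1_ge: "(\<Sum>j\<in>F. real n ^ 2 / real n ^ j) \<le> C1"
    if "finite F" "F \<subseteq> {j. 1 \<le> j \<and> j \<notin> J}" for F
    unfolding C1_def using that by (intro finite_sum_le_infsum geo) auto
  have C1: "0 \<le> C1" using C1_ge[of "{}"] by simp
  have "chi2 M S \<le> RHS"
  proof (cases "RHS = \<infinity>")
    case False
    have fin: "chi2 M (X k) < \<infinity>" if k: "k \<in> {1..n}" for k
    \<comment> \<open>If no positive index lies outside \<open>J\<close>, the coefficient is 0 and,
      as zero times infinity is zero, finiteness of \<open>RHS\<close> carries no information; all
      positive Hermite moments vanish instead. Otherwise \<open>C1 > 0\<close> and
      \<open>RHS\<close> bounds each summand.\<close>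
    proof (cases "{j. 1 \<le> j \<and> j \<notin> J} = {}")
      case True
      then have "chi2 M (X k) = 0"
        using assms(8)[OF _ k] k
        by (intro chi2_eq_0_of_He_moments) (auto simp: hermite_eq_He prob_space_axioms)
      then show ?thesis by simp
    next
      case False
      then obtain j where "1 \<le> j" "j \<notin> J" by auto
      then have "real n ^ 2 / real n ^ j \<le> C1" using C1_ge[of "{j}"] by simp
      moreover have "0 < real n ^ 2 / real n ^ j" using n by simp
      ultimately have "0 < C1" by linarith
      then have "(\<Sum>k=1..n. chi2 M (X k)) \<noteq> \<infinity>"
        using \<open>RHS \<noteq> \<infinity>\<close> n by (auto simp: RHS_def ennreal_mult_eq_top_iff)
      then show ?thesis
        using k by (auto simp: less_top)
    qed
    have e: "integrable M (\<lambda>\<omega>. exp (t * \<bar>X k \<omega>\<bar>))" if "k \<in> {1..n}" for k t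
      using chi2_finite_exp_integrable[OF assms(1) fin[OF that]] .
    define A where "A = (\<lambda>m. expectation (\<lambda>\<omega>. poly (He m) (S \<omega>)))"
    define a where "a = (\<lambda>k m. expectation (\<lambda>\<omega>. poly (He m) (X k \<omega>)))"
    define b where "b = (\<lambda>k m. expectation (\<lambda>\<omega>. poly (He m) (R k \<omega>)))"
    have A0: "A 0 = 1" by (simp add: A_def prob_space)
    have partial: "ennreal (\<Sum>m=1..N. (A m)\<^sup>2 / fact m) \<le> RHS" for N
    proof -
      let ?U = "\<lambda>k. \<Sum>j=1..N. (a k j)\<^sup>2 / fact j"
      let ?B = "\<lambda>k. \<Sum>s=1..N. (b k s)\<^sup>2 / fact s"
      have "real n * (\<Sum>j\<in>{1..N} - J. (1 / real n) ^ j) = (\<Sum>j\<in>{1..N} - J. real n ^ 2 / real n ^ j) * (1 / real n)"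
        unfolding sum_distrib_left sum_distrib_right
        using n by (intro sum.cong refl) (simp add: power_divide power2_eq_square)
      also have "\<dots> \<le> C1 * (1 / real n)"
        by (intro mult_right_mono C1_ge) auto
      finally have geo_le: "real n * (\<Sum>j\<in>{1..N} - J. (1 / real n) ^ j) \<le> C1 * (1 / real n)" .
      have "(\<Sum>m=1..N. (A m)\<^sup>2 / fact m) \<le>
        (\<Sum>k=1..n. ?U k * (real n * (\<Sum>j\<in>{1..N} - J. (1 / real n) ^ j) + C2 / real n * ?B k))"
        unfolding C2_def
      proof (rule He_moments_bound[OF n])
        show "real m * A m / fact m = (\<Sum>k=1..n. \<Sum>j\<le>m. real j * (a k j * (1 / sqrt n) ^ j / fact j) *
         (b k (m - j) * sqrt (1 - 1 / n) ^ (m - j) / fact (m - j)))" for m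
          unfolding A_def a_def b_def S_def R_def by (rule He_moments_sum_indep[OF n indep e])
        show "a k j = 0" if "k \<in> {1..n}" "j \<in> J" for k j
          using assms(8)[OF that(2,1)] by (simp add: a_def hermite_eq_He)
        show "b k 0 = 1" for k by (simp add: b_def prob_space)
      qed
      also have "\<dots> \<le> (\<Sum>k=1..n. ?U k * (C1 * (1 / real n) + C2 / real n * ?B k))"
        using geo_le by (intro sum_mono mult_left_mono add_mono order_refl sum_nonneg) auto
      finally have "ennreal (\<Sum>m=1..N. (A m)\<^sup>2 / fact m) \<le>
          ennreal (\<Sum>k=1..n. ?U k * (C1 * (1 / real n) + C2 / real n * ?B k))"
        by (rule ennreal_leI)
      also have "\<dots> = (\<Sum>k=1..n. ennreal (?U k) * (ennreal C1 * ennreal (1 / real n) + ennreal (C2 / real n) * ennreal (?B k)))"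
        using C1 C2 by (subst sum_ennreal[symmetric]) (auto intro!: sum.cong mult_nonneg_nonneg add_nonneg_nonneg sum_nonneg
            simp: ennreal_mult' ennreal_plus sum_nonneg simp flip: ennreal_mult)
      \<comment> \<open>Bessel's inequality is applied to \<open>X k\<close> and to
        \<open>R k\<close>; it also covers an infinite value of \<open>chi2 M (R k)\<close>.\<close>
      also have "\<dots> \<le> (\<Sum>k=1..n. chi2 M (X k) * (ennreal C1 * ennreal (1 / real n) + ennreal (C2 / real n) * chi2 M (R k)))"
        unfolding a_def b_def
        by (intro sum_mono mult_mono add_mono order_refl chi2_Bessel[OF assms(1)]) auto
      also have "\<dots> = RHS"
        by (simp add: RHS_def sum_distrib_left distrib_left sum.distrib mult_ac)
      finally show ?thesis .
    qed
    obtain r where r: "0 \<le> r" "RHS = ennreal r"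
      using False by (cases RHS) auto
    have shift: "(\<Sum>m<N. (A (Suc m))\<^sup>2 / fact (Suc m)) \<le> r" for N
    proof -
      have "(\<Sum>m<N. (A (Suc m))\<^sup>2 / fact (Suc m)) = (\<Sum>m=1..N. (A m)\<^sup>2 / fact m)"
        by (rule sum.reindex_bij_witness[of _ "\<lambda>m. m - 1" Suc]) auto
      then show ?thesis using partial[of N] r by (simp del: fact_Suc)
    qed
    \<comment> \<open>The uniform bound on the partial sums gives the summability that
      Riesz--Fischer requires.\<close>
    have summ: "summable (\<lambda>m. (A (Suc m))\<^sup>2 / fact (Suc m))"
      using shift by (intro summableI_nonneg_bounded[where x = r]) auto
    \<comment> \<open>Needed because \<open>chi2\<close> is infinite by definition in the absence of
      a density.\<close>
    have dens: "\<exists>q. distributed M lborel S q"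
    proof -
      have "\<exists>q. distributed M lborel (X k) q" if "k \<in> {1..n}" for k
        using fin[OF that] by (auto simp: chi2_def split: if_splits)
      then have "\<exists>q. distributed M lborel (\<lambda>\<omega>. \<Sum>k=1..n. X k \<omega>) q"
        using n indep by (intro distributed_sum_indep) auto
      then obtain q where "distributed M lborel (\<lambda>\<omega>. \<Sum>k=1..n. X k \<omega>) q" by blast
      from distributed_affine[OF this, of "1 / sqrt (real n)" 0] show ?thesis
        using n by (auto simp: S_def)
    qed
    then obtain q where "distributed M lborel S q" by blast
    then have "chi2 M S \<le> ennreal (\<Sum>m. (A (Suc m))\<^sup>2 / fact (Suc m))"
      unfolding A_def
    proof (rule chi2_le_He_moments[OF assms(1)])
      show "integrable M (\<lambda>\<omega>. exp (t * \<bar>S \<omega>\<bar>))" for t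
        unfolding S_def by (rule exp_integrable_sum_indep[OF _ indep e]) auto
      show "summable (\<lambda>m. (expectation (\<lambda>\<omega>. poly (He m) (S \<omega>)))\<^sup>2 / fact m)"
        using summ unfolding A_def by (subst summable_Suc_iff[symmetric])
    qed
    also have "\<dots> \<le> RHS"
      unfolding r(2) by (intro ennreal_leI suminf_le_const summ shift)
    finally show ?thesis .
  qed simp
  then show ?thesis unfolding S_def R_def RHS_def C1_def C2_def .
qed

end
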